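(* Let $\beta$ be the OGD-CB algorithm. When $\mathbb E_{v\sim F,p\sim G}[p\mathbf 1[v\ge p]]\le\rho$, under full or partial information feedback, \[\Big|\mathbb E_{\bm v,\bm p,\bm\gamma}\big[R^{\mathrm{thr}}\big]-\mathbb E_{\bm v,\bm p}\big[R^{\mathrm{pac}}\big]\Big|=O\big(\sqrt{T\log T}\big),\qquad \Big|\mathbb E_{\bm v,\bm p}\big[R^{\beta}\big]-\mathbb E_{\bm v,\bm p}\big[R^{\mathrm{pac}}\big]\Big|=O\big(\sqrt{T\log T}\big).\]
   Context: Model: constants $\bar v>0$, $\rho\in(0,\bar v]$; $T$ rounds; budget $B=\rho T$. Values $v_t$ i.i.d. from $F$ on $[0,\bar v]$; highest competing bids $p_t$ i.i.d. from $G$ on $[0,\bar v]$, independent of values, unknown to the buyer. Throttling: each round the buyer chooses $x_t\in\{0,1\}$ after seeing $v_t$, receiving $x_tr_t$, $r_t=(v_t-p_t)^+$, and paying $x_tc_t$, $c_t=p_t\mathbf 1[v_t\ge p_t]$; an online throttling strategy sets $x_t=\beta_t(\mathcal H_t,v_t,\gamma_t)$ with internal randomness and history of past values, decisions and observed bids (full information: $p_t$ always observed; partial: only when $x_t=1$), keeping payment within $B$; revenue $\sum_{t=1}^{T_0}x_tr_t$, $T_0$ the ending time. $R^{\mathrm{thr}}$: revenue of the throttling strategy maximizing expected revenue. $R^{\mathrm{pac}}$: revenue of the adaptive pacing strategy of Balseiro and Gur (2019): step size $\varepsilon$ of order $T^{-1/2}$, cap $\bar\mu\ge\bar v/\rho$,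 $\mu_1\in[0,\bar\mu]$, $\tilde B_1=B$; each round bid $b_t=\min\{v_t/(1+\mu_t),\tilde B_t\}$ (win iff $b_t\ge p_t$, pay $p_t$, gain $v_t-p_t$), expenditure $z_t=p_t\mathbf 1[b_t\ge p_t]$, update $\mu_{t+1}=\mathrm{Proj}_{[0,\bar\mu]}(\mu_t-\varepsilon(\rho-z_t))$, $\tilde B_{t+1}=\tilde B_t-z_t$. OGD-CB algorithm: $\mathcal I_1=\emptyset$, $B_1=B$, $\lambda_1=0$. For $t=1,\dots,T$: observe $v_t$. If $t=1$: $x_1=1$, $\lambda_2=\lambda_1$. Otherwise: $\epsilon_t=\sqrt{(\ln 2+2\ln T)/(2|\mathcal I_t|)}$; $\tilde r_t(v)=\frac1{|\mathcal I_t|}\sum_{\tau\in\mathcal I_t}(v-p_\tau)^++\epsilon_tv$; $\tilde c_t(v)=\frac1{|\mathcal I_t|}\sum_{\tau\in\mathcal I_t}p_\tau\mathbf 1[v\ge p_\tau]-2\epsilon_tv$; $x_t=\mathbf 1[\tilde r_t(v_t)\ge\lambda_t\tilde c_t(v_t)]$; $\eta_t=1/(\bar v\sqrt t)$; $\lambda_{t+1}=(\lambda_t+\eta_t(x_t\tilde c_t(v_t)-\rho))^+$. If (full information) or (partial and $x_t=1$) observe $p_t$ and set $\mathcal I_{t+1}=\mathcal I_t\cup\{t\}$, else $\mathcal I_{t+1}=\mathcal I_t$. Set $B_{t+1}=B_t-x_tc_t$; if $B_{t+1}<\bar v$, stop. *)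

theory Defs
  imports "HOL-Probability.Probability" "HOL-Library.Landau_Symbols"
begin

section \<open>Basic quantities (rounds are indexed 1..T)\<close>

definition rwd :: "real \<Rightarrow> real \<Rightarrow> real" where
  "rwd v p = max (v - p) 0"

definition cst :: "real \<Rightarrow> real \<Rightarrow> real" where
  "cst v p = (if p \<le> v then p else 0)"

text \<open>Sample space: i.i.d. rounds, each carrying (value, highest competing bid,
  internal random number uniform on [0,1]).\<close>

definition sample_space :: "real measure \<Rightarrow> real measure \<Rightarrow> (nat \<Rightarrow> real \<times> real \<times> real) measure" where
  "sample_space F G = PiM UNIV (\<lambda>_::nat. F \<Otimes>\<^sub>M (G \<Otimes>\<^sub>M uniform_measure lborel {0..1::real}))"

definition vv :: "(nat \<Rightarrow> real \<times> real \<times> real) \<Rightarrow> nat \<Rightarrow> real" where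
  "vv \<omega> t = fst (\<omega> t)"
definition pp :: "(nat \<Rightarrow> real \<times> real \<times> real) \<Rightarrow> nat \<Rightarrow> real" where
  "pp \<omega> t = fst (snd (\<omega> t))"
definition gg :: "(nat \<Rightarrow> real \<times> real \<times> real) \<Rightarrow> nat \<Rightarrow> real" where
  "gg \<omega> t = snd (snd (\<omega> t))"

text \<open>History entry of a past round: (value, decision, observed bid).
  The bid is observed always under full information (full = True), and only
  when x = 1 under partial information.\<close>

type_synonym hist = "(real \<times> bool \<times> real option) list"
type_synonym thr_strategy = "hist \<Rightarrow> real \<Rightarrow> real \<Rightarrow> bool"

definition obs :: "bool \<Rightarrow> bool \<Rightarrow> real \<Rightarrow> real option" where
  "obs full x p = (if full \<or> x then Some p else None)"

primrec thr_hist :: "thr_strategy \<Rightarrow> bool \<Rightarrow> (nat \<Rightarrow> real) \<Rightarrow> (nat \<Rightarrow> real) \<Rightarrow> (nat \<Rightarrow> real) \<Rightarrow> nat \<Rightarrow> hist" where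
  "thr_hist \<beta> full v p g 0 = []"
| "thr_hist \<beta> full v p g (Suc t) =
     (let h = thr_hist \<beta> full v p g t; x = \<beta> h (v (Suc t)) (g (Suc t))
      in h @ [(v (Suc t), x, obs full x (p (Suc t)))])"

definition thr_dec :: "thr_strategy \<Rightarrow> bool \<Rightarrow> (nat \<Rightarrow> real) \<Rightarrow> (nat \<Rightarrow> real) \<Rightarrow> (nat \<Rightarrow> real) \<Rightarrow> nat \<Rightarrow> bool" where
  "thr_dec \<beta> full v p g t = \<beta> (thr_hist \<beta> full v p g (t - 1)) (v t) (g t)"

definition thr_rev :: "thr_strategy \<Rightarrow> bool \<Rightarrow> (nat \<Rightarrow> real) \<Rightarrow> (nat \<Rightarrow> real) \<Rightarrow> (nat \<Rightarrow> real) \<Rightarrow> nat \<Rightarrow> real" where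
  "thr_rev \<beta> full v p g T = (\<Sum>t = 1..T. if thr_dec \<beta> full v p g t then rwd (v t) (p t) else 0)"

definition thr_pay :: "thr_strategy \<Rightarrow> bool \<Rightarrow> (nat \<Rightarrow> real) \<Rightarrow> (nat \<Rightarrow> real) \<Rightarrow> (nat \<Rightarrow> real) \<Rightarrow> nat \<Rightarrow> real" where
  "thr_pay \<beta> full v p g T = (\<Sum>t = 1..T. if thr_dec \<beta> full v p g t then cst (v t) (p t) else 0)"

definition thr_admissible :: "thr_strategy \<Rightarrow> bool \<Rightarrow> real \<Rightarrow> real \<Rightarrow> nat \<Rightarrow> bool" where
  "thr_admissible \<beta> full vbar B T =
     (\<forall>v p g. (\<forall>t. 0 \<le> v t \<and> v t \<le> vbar \<and> 0 \<le> p t \<and> p t \<le> vbar \<and> 0 \<le> g t \<and> g t \<le> 1)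
        \<longrightarrow> thr_pay \<beta> full v p g T \<le> B)"

definition exp_thr_opt :: "real measure \<Rightarrow> real measure \<Rightarrow> bool \<Rightarrow> real \<Rightarrow> real \<Rightarrow> nat \<Rightarrow> real" where
  "exp_thr_opt F G full vbar rho T =
     Sup ((\<lambda>\<beta>. \<integral>\<omega>. thr_rev \<beta> full (vv \<omega>) (pp \<omega>) (gg \<omega>) T \<partial>sample_space F G)
          ` {\<beta>. thr_admissible \<beta> full vbar (rho * real T) T})"

section \<open>Adaptive pacing (Balseiro and Gur 2019)\<close>

text \<open>pac_state ... t = (mu_{t+1}, tilde B_{t+1}).\<close>

primrec pac_state :: "real \<Rightarrow> real \<Rightarrow> real \<Rightarrow> real \<Rightarrow> real \<Rightarrow> (nat \<Rightarrow> real) \<Rightarrow> (nat \<Rightarrow> real) \<Rightarrow> nat \<Rightarrow> real \<times> real" where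
  "pac_state eps mubar mu1 B rho v p 0 = (mu1, B)"
| "pac_state eps mubar mu1 B rho v p (Suc t) =
     (let st = pac_state eps mubar mu1 B rho v p t; mu = fst st; Bt = snd st;
          b = min (v (Suc t) / (1 + mu)) Bt;
          z = (if p (Suc t) \<le> b then p (Suc t) else 0)
      in (max 0 (min mubar (mu - eps * (rho - z))), Bt - z))"

definition pac_bid :: "real \<Rightarrow> real \<Rightarrow> real \<Rightarrow> real \<Rightarrow> real \<Rightarrow> (nat \<Rightarrow> real) \<Rightarrow> (nat \<Rightarrow> real) \<Rightarrow> nat \<Rightarrow> real" where
  "pac_bid eps mubar mu1 B rho v p t =
     (let st = pac_state eps mubar mu1 B rho v p (t - 1) in min (v t / (1 + fst st)) (snd st))"

definition pac_rev :: "real \<Rightarrow> real \<Rightarrow> real \<Rightarrow> real \<Rightarrow> real \<Rightarrow> (nat \<Rightarrow> real) \<Rightarrow> (nat \<Rightarrow> real) \<Rightarrow> nat \<Rightarrow> real" where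
  "pac_rev eps mubar mu1 B rho v p T =
     (\<Sum>t = 1..T. if p t \<le> pac_bid eps mubar mu1 B rho v p t then v t - p t else 0)"

definition exp_pac :: "real measure \<Rightarrow> real measure \<Rightarrow> (nat \<Rightarrow> real) \<Rightarrow> real \<Rightarrow> real \<Rightarrow> real \<Rightarrow> nat \<Rightarrow> real" where
  "exp_pac F G eps mubar mu1 rho T =
     (\<integral>\<omega>. pac_rev (eps T) mubar mu1 (rho * real T) rho (vv \<omega>) (pp \<omega>) T \<partial>sample_space F G)"

text \<open>State after a round: (observed bids p_tau for tau in I, lambda, remaining budget, stopped).\<close>

type_synonym ogd_st = "real list \<times> real \<times> real \<times> bool"

definition ogd_eps :: "nat \<Rightarrow> nat \<Rightarrow> real" where
  "ogd_eps T n = sqrt ((ln 2 + 2 * ln (real T)) / (2 * real n))"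

definition ogd_r :: "real list \<Rightarrow> real \<Rightarrow> real \<Rightarrow> real" where
  "ogd_r qs e x = (\<Sum>q\<leftarrow>qs. rwd x q) / real (length qs) + e * x"

definition ogd_c :: "real list \<Rightarrow> real \<Rightarrow> real \<Rightarrow> real" where
  "ogd_c qs e x = (\<Sum>q\<leftarrow>qs. cst x q) / real (length qs) - 2 * e * x"

definition ogd_dec :: "real \<Rightarrow> real \<Rightarrow> nat \<Rightarrow> nat \<Rightarrow> real \<Rightarrow> ogd_st \<Rightarrow> bool \<times> real" where
  "ogd_dec vbar rho T t vt st =
     (let qs = fst st; lam = fst (snd st); stop = snd (snd (snd st)) in
      if stop then (False, lam)
      else if t = 1 then (True, lam)
      else (let e = ogd_eps T (length qs); ct = ogd_c qs e vt;
                x = (ogd_r qs e vt \<ge> lam * ct)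
            in (x, max 0 (lam + (1 / (vbar * sqrt (real t))) * ((if x then ct else 0) - rho)))))"

primrec ogd_state :: "bool \<Rightarrow> real \<Rightarrow> real \<Rightarrow> nat \<Rightarrow> (nat \<Rightarrow> real) \<Rightarrow> (nat \<Rightarrow> real) \<Rightarrow> nat \<Rightarrow> ogd_st" where
  "ogd_state full vbar rho T v p 0 = ([], 0, rho * real T, False)"
| "ogd_state full vbar rho T v p (Suc t) =
     (let st = ogd_state full vbar rho T v p t in
      if snd (snd (snd st)) then st
      else (let d = ogd_dec vbar rho T (Suc t) (v (Suc t)) st; x = fst d;
                qs' = (if full \<or> x then fst st @ [p (Suc t)] else fst st);
                B' = fst (snd (snd st)) - (if x then cst (v (Suc t)) (p (Suc t)) else 0)
            in (qs', snd d, B', B' < vbar)))"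

definition ogd_x :: "bool \<Rightarrow> real \<Rightarrow> real \<Rightarrow> nat \<Rightarrow> (nat \<Rightarrow> real) \<Rightarrow> (nat \<Rightarrow> real) \<Rightarrow> nat \<Rightarrow> bool" where
  "ogd_x full vbar rho T v p t = fst (ogd_dec vbar rho T t (v t) (ogd_state full vbar rho T v p (t - 1)))"

definition ogd_rev :: "bool \<Rightarrow> real \<Rightarrow> real \<Rightarrow> (nat \<Rightarrow> real) \<Rightarrow> (nat \<Rightarrow> real) \<Rightarrow> nat \<Rightarrow> real" where
  "ogd_rev full vbar rho v p T = (\<Sum>t = 1..T. if ogd_x full vbar rho T v p t then rwd (v t) (p t) else 0)"

definition exp_ogd :: "real measure \<Rightarrow> real measure \<Rightarrow> bool \<Rightarrow> real \<Rightarrow> real \<Rightarrow> nat \<Rightarrow> real" where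
  "exp_ogd F G full vbar rho T = (\<integral>\<omega>. ogd_rev full vbar rho (vv \<omega>) (pp \<omega>) T \<partial>sample_space F G)"

end

theory Submission
  imports Defs "HOL-Real_Asymp.Real_Asymp"
begin

text \<open>
  All three expected revenues lie within \<open>O(sqrt (T ln T))\<close> of \<open>T * Rew\<close>, where \<open>Rew\<close> is the expected
  reward of a round in which the buyer participates unconditionally. No strategy earns more than
  \<open>T * Rew\<close>, and OGD-CB is itself a throttling strategy, so only lower bounds for OGD-CB and for
  adaptive pacing are needed.

  Pacing: a lost round \<open>t\<close> costs at most \<open>mu_t (c_t - z_t)\<close>. The dual gradient step controls
  \<open>\<Sum> mu_t (rho - z_t)\<close>, and \<open>mu_t\<close> is independent of round \<open>t\<close>, so \<open>E[mu_t (c_t - rho)] \<le> 0\<close>. The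
  multiplier also records the overspending, which therefore is at most \<open>mubar / eps\<close>; the budget binds
  only in the last \<open>O(sqrt T)\<close> rounds.

  OGD-CB: on the event that the empirical means are \<open>epsilon\<close>-accurate, optimism bounds the loss of a
  round by \<open>lambda_t (cbar (v_t) - x_t ctilde_t)\<close>, which is handled in the same way. The multiplier
  bounds \<open>\<Sum> x_t ctilde_t - rho\<close>, and together with the confidence widths and the second moment of the
  martingale \<open>\<Sum> x_t (c_t - cbar (v_t))\<close> this bounds the number of rounds after the budget is exhausted.
\<close>

subsection \<open>Resampling one round\<close>

text \<open>No filtration or conditional expectation is used. That a quantity does not depend on a
  round is stated as invariance under \<open>w(t := y)\<close>, and Fubini on the product measure
  turns this invariance into independence. A decision sees the value of its round but not the bid,
  so there are two versions: one redraws the bid alone, the other the whole round. Two obstacles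
  shape the OGD-CB part. While few bids are known the confidence width is large; but only rounds
  with \<open>x = 1\<close> suffer from it, and each of them adds an observation, so the sums of the
  widths and of their squares telescope along the number of observed bids. Moreover the size of the
  multiplier enters every bound; it can rise only when the buyer participates at an estimated cost
  above \<open>rho\<close>, and this already forces it to be at most
  \<open>3 * vbar / (2 * rho)\<close>. Only the sum of the widths has order
  \<open>sqrt (T ln T)\<close>; all other terms are \<open>O(sqrt T)\<close> or
  \<open>O((ln T)^2)\<close>.\<close>

text \<open>Values and bids lie in \<open>{0..vbar}\<close> only almost surely; clipping makes all bounds hold pointwise.\<close>

definition clip :: "real \<Rightarrow> real \<Rightarrow> real" where
  "clip b x = max 0 (min b x)"

lemma clip_bounds: "0 \<le> b \<Longrightarrow> 0 \<le> clip b x" "0 \<le> b \<Longrightarrow> clip b x \<le> b"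
  by (auto simp: clip_def)

lemma clip_id: "x \<in> {0..b} \<Longrightarrow> clip b x = x"
  by (auto simp: clip_def)

lemma clip_measurable [measurable]: "clip b \<in> borel_measurable borel"
  unfolding clip_def by measurable

lemma rwd_measurable [measurable (raw)]:
  assumes [measurable]: "f \<in> borel_measurable M" "g \<in> borel_measurable M"
  shows "(\<lambda>x. rwd (f x) (g x)) \<in> borel_measurable M"
  unfolding rwd_def by measurable

lemma cst_measurable [measurable (raw)]:
  assumes [measurable]: "f \<in> borel_measurable M" "g \<in> borel_measurable M"
  shows "(\<lambda>x. cst (f x) (g x)) \<in> borel_measurable M"
  unfolding cst_def by measurable

lemma rwd_bounds: "0 \<le> v \<Longrightarrow> 0 \<le> p \<Longrightarrow> 0 \<le> rwd v p" "0 \<le> v \<Longrightarrow> 0 \<le> p \<Longrightarrow> rwd v p \<le> v"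
  by (auto simp: rwd_def)

lemma cst_bounds: "0 \<le> v \<Longrightarrow> 0 \<le> p \<Longrightarrow> 0 \<le> cst v p" "0 \<le> v \<Longrightarrow> 0 \<le> p \<Longrightarrow> cst v p \<le> v"
  by (auto simp: cst_def)

locale auction =
  fixes vbar :: real and F G :: "real measure"
  assumes vbar_pos: "0 < vbar"
    and prob_F: "prob_space F" and sets_F: "sets F = sets borel" and F_supp: "measure F {0..vbar} = 1"
    and prob_G: "prob_space G" and sets_G: "sets G = sets borel" and G_supp: "measure G {0..vbar} = 1"
begin

sublocale F: prob_space F by (rule prob_F)
sublocale G: prob_space G by (rule prob_G)

definition U :: "real measure" where "U = uniform_measure lborel {0..1}"

definition round :: "(real \<times> real \<times> real) measure" where "round = F \<Otimes>\<^sub>M (G \<Otimes>\<^sub>M U)"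

definition P :: "(nat \<Rightarrow> real \<times> real \<times> real) measure" where "P = sample_space F G"

lemma P_eq: "P = PiM UNIV (\<lambda>_::nat. round)"
  unfolding P_def sample_space_def round_def U_def ..

lemma prob_U: "prob_space U"
  unfolding U_def by (rule prob_space_uniform_measure) auto

sublocale U: prob_space U by (rule prob_U)
sublocale GU: pair_prob_space G U ..
sublocale R: pair_prob_space F "G \<Otimes>\<^sub>M U" ..

lemma prob_round: "prob_space round"
  unfolding round_def by (rule R.prob_space_axioms)

sublocale round: prob_space round by (rule prob_round)

lemma prob_P: "prob_space P"
  unfolding P_eq by (rule prob_space_PiM) (rule prob_round)

sublocale P: prob_space P by (rule prob_P)
sublocale PG: pair_prob_space P G ..
sublocale PF: pair_prob_space P F ..

lemma sets_U: "sets U = sets borel" by (simp add: U_def)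

declare sets_F [simp, measurable_cong] sets_G [simp, measurable_cong] sets_U [simp, measurable_cong]

lemma sets_round [measurable_cong]: "sets round = sets (borel \<Otimes>\<^sub>M (borel \<Otimes>\<^sub>M borel))"
  unfolding round_def by (intro sets_pair_measure_cong sets_F sets_G sets_U)

lemma space_F [simp]: "space F = UNIV" using sets_eq_imp_space_eq[OF sets_F] by simp
lemma space_G [simp]: "space G = UNIV" using sets_eq_imp_space_eq[OF sets_G] by simp
lemma space_U [simp]: "space U = UNIV" using sets_eq_imp_space_eq[OF sets_U] by simp
lemma space_round [simp]: "space round = UNIV"
  unfolding round_def by (simp add: space_pair_measure)
lemma space_P [simp]: "space P = UNIV"
  unfolding P_eq by (simp add: space_PiM)

lemma sets_P [measurable_cong]: "sets P = sets (PiM UNIV (\<lambda>_::nat. borel \<Otimes>\<^sub>M (borel \<Otimes>\<^sub>M borel)))"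
  unfolding P_eq by (intro sets_PiM_cong sets_round) auto

lemma vv_measurable [measurable]: "(\<lambda>w. vv w t) \<in> borel_measurable P"
  unfolding vv_def by measurable

lemma pp_measurable [measurable]: "(\<lambda>w. pp w t) \<in> borel_measurable P"
  unfolding pp_def by measurable

lemma integrable_bounded:
  assumes "finite_measure M" "f \<in> borel_measurable M" "\<And>x. \<bar>f x\<bar> \<le> (K::real)"
  shows "integrable M f"
  using assms by (intro finite_measure.integrable_const_bound[of M f K]) auto

lemma distr_update: "distr (round \<Otimes>\<^sub>M P) P (\<lambda>(y, w). w(t := y)) = P"
  using distr_pair_PiM_eq_PiM[of UNIV "\<lambda>_::nat. round" t] prob_round
  unfolding P_eq by simp

lemma update_measurable [measurable]: "(\<lambda>(y, w). w(t := y)) \<in> measurable (round \<Otimes>\<^sub>M P) P"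
  unfolding P_eq split_def by (rule measurable_fun_upd[where J = UNIV]) auto

text \<open>Redrawing coordinate \<open>t\<close> independently preserves the product measure
  (\<open>distr_update\<close>), so by Fubini a bounded function may first be averaged over a fresh
  round.\<close>

lemma resample:
  assumes [measurable]: "\<phi> \<in> borel_measurable P" and bd: "\<And>w. \<bar>\<phi> w\<bar> \<le> (K::real)"
  shows "(\<integral>w. \<phi> w \<partial>P) = (\<integral>w. (\<integral>y. \<phi> (w(t := y)) \<partial>round) \<partial>P)"
proof -
  interpret RP: pair_prob_space round P ..
  have meas: "(\<lambda>(y, w). \<phi> (w(t := y))) \<in> borel_measurable (round \<Otimes>\<^sub>M P)"
    using measurable_compose[OF update_measurable assms(1)] by (simp add: split_def)
  have "(\<integral>w. \<phi> w \<partial>P) = (\<integral>w. \<phi> w \<partial>distr (round \<Otimes>\<^sub>M P) P (\<lambda>(y, w). w(t := y)))"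
    by (simp only: distr_update)
  also have "\<dots> = (\<integral>z. \<phi> ((\<lambda>(y, w). w(t := y)) z) \<partial>(round \<Otimes>\<^sub>M P))"
    by (rule integral_distr) measurable
  also have "\<dots> = (\<integral>z. (\<lambda>(y, w). \<phi> (w(t := y))) z \<partial>(round \<Otimes>\<^sub>M P))"
    by (simp add: split_def)
  also have "\<dots> = (\<integral>w. (\<integral>y. \<phi> (w(t := y)) \<partial>round) \<partial>P)"
    by (rule RP.integral_snd[symmetric], rule integrable_bounded[where K = K])
       (use meas bd in \<open>auto simp: RP.finite_measure_axioms\<close>)
  finally show ?thesis .
qed

lemma integral_round:
  assumes [measurable]: "h \<in> borel_measurable round" and bd: "\<And>y. \<bar>h y\<bar> \<le> (K::real)"
  shows "(\<integral>y. h y \<partial>round) = (\<integral>v. (\<integral>p. (\<integral>g. h (v, p, g) \<partial>U) \<partial>G) \<partial>F)"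
proof -
  have m[measurable]: "h \<in> borel_measurable (F \<Otimes>\<^sub>M (G \<Otimes>\<^sub>M U))"
    using assms(1) unfolding round_def .
  have "(\<integral>y. h y \<partial>round) = (\<integral>v. (\<integral>z. h (v, z) \<partial>(G \<Otimes>\<^sub>M U)) \<partial>F)"
    unfolding round_def
    by (rule R.integral_fst'[symmetric], rule integrable_bounded[where K = K])
       (use bd in \<open>auto simp: R.finite_measure_axioms\<close>)
  also have "\<dots> = (\<integral>v. (\<integral>p. (\<integral>g. h (v, p, g) \<partial>U) \<partial>G) \<partial>F)"
  proof (rule Bochner_Integration.integral_cong[OF refl])
    fix v
    have "(\<lambda>z. h (v, z)) \<in> borel_measurable (G \<Otimes>\<^sub>M U)"
      by (rule measurable_compose[OF measurable_Pair1' m]) simp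
    then show "(\<integral>z. h (v, z) \<partial>(G \<Otimes>\<^sub>M U)) = (\<integral>p. (\<integral>g. h (v, p, g) \<partial>U) \<partial>G)"
      by (intro GU.integral_fst'[symmetric] integrable_bounded[where K = K])
         (use bd in \<open>auto simp: GU.finite_measure_axioms\<close>)
  qed
  finally show ?thesis .
qed

lemma abs_integral_le:
  assumes "prob_space M" "\<And>x. \<bar>f x\<bar> \<le> (K::real)"
  shows "\<bar>\<integral>x. f x \<partial>M\<bar> \<le> K"
proof -
  interpret prob_space M by fact
  have "0 \<le> K" using assms(2)[of undefined] by linarith
  show ?thesis
  proof (cases "integrable M f")
    case True
    have "(\<integral>x. f x \<partial>M) \<le> (\<integral>x. K \<partial>M)" "(\<integral>x. - K \<partial>M) \<le> (\<integral>x. f x \<partial>M)"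
      using assms(2) True by (intro integral_mono; auto simp: abs_le_iff minus_le_iff)+
    then show ?thesis by (simp add: prob_space abs_le_iff)
  qed (simp add: not_integrable_integral_eq \<open>0 \<le> K\<close>)
qed

text \<open>The bid of round \<open>t\<close> is independent of the rest of the sample, including
  the value of the same round. Hence \<open>inv\<close> lets \<open>\<psi>\<close> keep
  \<open>v\<close>, on which the decision of round \<open>t\<close> depends, and asks only that bid
  and internal randomness do not matter.\<close>

lemma resample_bid:
  assumes m[measurable]: "(\<lambda>(w, p). \<psi> w p) \<in> borel_measurable (P \<Otimes>\<^sub>M borel)"
    and bd: "\<And>w p. \<bar>\<psi> w p\<bar> \<le> (K::real)"
    and inv: "\<And>w v p p' g g' q. \<psi> (w(t := (v, p, g))) q = \<psi> (w(t := (v, p', g'))) q"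
  shows "(\<integral>w. \<psi> w (pp w t) \<partial>P) = (\<integral>w. (\<integral>p. \<psi> w p \<partial>G) \<partial>P)"
proof -
  have mG: "(\<lambda>(w, p). \<psi> w p) \<in> borel_measurable (P \<Otimes>\<^sub>M G)"
    using m by (simp cong: measurable_cong_sets sets_pair_measure_cong)
  have upd: "(\<lambda>y. w(t := y)) \<in> measurable round P" for w
    using measurable_compose[OF measurable_Pair2'[of w P round] update_measurable[of t]] by simp
  have m1: "(\<lambda>w. \<psi> w (pp w t)) \<in> borel_measurable P"
    using measurable_compose[OF measurable_Pair[OF measurable_ident_sets[OF refl] pp_measurable] m] by simp
  have m2: "(\<lambda>w. \<integral>p. \<psi> w p \<partial>G) \<in> borel_measurable P"
    using mG by (rule G.borel_measurable_lebesgue_integral)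
  have bd2: "\<bar>\<integral>p. \<psi> w p \<partial>G\<bar> \<le> K" for w
    using prob_G bd by (rule abs_integral_le)
  have "(\<integral>w. \<psi> w (pp w t) \<partial>P) =
      (\<integral>w. (\<integral>y. \<psi> (w(t := y)) (pp (w(t := y)) t) \<partial>round) \<partial>P)"
    using m1 bd by (rule resample)
  also have "\<dots> = (\<integral>w. (\<integral>v. (\<integral>p. (\<integral>g. \<psi> (w(t := (v, p, g))) p \<partial>U) \<partial>G) \<partial>F) \<partial>P)"
    by (subst integral_round[OF measurable_compose[OF upd m1], where K = K]) (auto simp: bd pp_def)
  \<comment> \<open>By \<open>inv\<close> the bid and randomness inside the first argument can be
    frozen at 0. The other occurrence of the bid is then an integration variable of its own, and the
    round can be put back around it.\<close>
  also have "\<dots> = (\<integral>w. (\<integral>v. (\<integral>p. (\<integral>g. \<psi> (w(t := (v, 0, 0))) p \<partial>U) \<partial>G) \<partial>F) \<partial>P)"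
    by (intro Bochner_Integration.integral_cong refl inv)
  also have "\<dots> = (\<integral>w. (\<integral>v. (\<integral>p. (\<integral>g. (\<integral>q. \<psi> (w(t := (v, 0, 0))) q \<partial>G) \<partial>U) \<partial>G) \<partial>F) \<partial>P)"
    by (simp add: G.prob_space[simplified] U.prob_space[simplified])
  also have "\<dots> = (\<integral>w. (\<integral>v. (\<integral>p. (\<integral>g. (\<integral>q. \<psi> (w(t := (v, p, g))) q \<partial>G) \<partial>U) \<partial>G) \<partial>F) \<partial>P)"
    by (intro Bochner_Integration.integral_cong refl inv)
  also have "\<dots> = (\<integral>w. (\<integral>y. (\<integral>q. \<psi> (w(t := y)) q \<partial>G) \<partial>round) \<partial>P)"
    by (subst integral_round[OF measurable_compose[OF upd m2], where K = K]) (auto simp: bd2)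
  also have "\<dots> = (\<integral>w. (\<integral>p. \<psi> w p \<partial>G) \<partial>P)"
    using m2 bd2 by (rule resample[symmetric])
  finally show ?thesis .
qed

text \<open>Here \<open>\<psi>\<close> must ignore round \<open>t\<close> altogether, as a
  multiplier fixed before the round does.\<close>

lemma resample_value:
  assumes m[measurable]: "(\<lambda>(w, p). \<psi> w p) \<in> borel_measurable (P \<Otimes>\<^sub>M borel)"
    and bd: "\<And>w p. \<bar>\<psi> w p\<bar> \<le> (K::real)"
    and inv: "\<And>w y z q. \<psi> (w(t := y)) q = \<psi> (w(t := z)) q"
  shows "(\<integral>w. \<psi> w (vv w t) \<partial>P) = (\<integral>w. (\<integral>v. \<psi> w v \<partial>F) \<partial>P)"
proof -
  have upd: "(\<lambda>y. w(t := y)) \<in> measurable round P" for w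
    using measurable_compose[OF measurable_Pair2'[of w P round] update_measurable[of t]] by simp
  have m1: "(\<lambda>w. \<psi> w (vv w t)) \<in> borel_measurable P"
    using measurable_compose[OF measurable_Pair[OF measurable_ident_sets[OF refl] vv_measurable] m] by simp
  have inv': "\<psi> (w(t := y)) q = \<psi> w q" for w y q
    using inv[of w y q "w t"] by simp
  have "(\<integral>w. \<psi> w (vv w t) \<partial>P) =
      (\<integral>w. (\<integral>y. \<psi> (w(t := y)) (vv (w(t := y)) t) \<partial>round) \<partial>P)"
    using m1 bd by (rule resample)
  also have "\<dots> = (\<integral>w. (\<integral>v. (\<integral>p. (\<integral>g. \<psi> (w(t := (v, p, g))) v \<partial>U) \<partial>G) \<partial>F) \<partial>P)"
    by (subst integral_round[OF measurable_compose[OF upd m1], where K = K]) (auto simp: bd vv_def)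
  also have "\<dots> = (\<integral>w. (\<integral>v. \<psi> w v \<partial>F) \<partial>P)"
    by (simp add: inv' G.prob_space[simplified] U.prob_space[simplified])
  finally show ?thesis .
qed

definition V :: "(nat \<Rightarrow> real \<times> real \<times> real) \<Rightarrow> nat \<Rightarrow> real" where
  "V w t = clip vbar (vv w t)"

definition Q :: "(nat \<Rightarrow> real \<times> real \<times> real) \<Rightarrow> nat \<Rightarrow> real" where
  "Q w t = clip vbar (pp w t)"

lemma V_measurable [measurable]: "(\<lambda>w. V w t) \<in> borel_measurable P"
  unfolding V_def by measurable

lemma Q_measurable [measurable]: "(\<lambda>w. Q w t) \<in> borel_measurable P"
  unfolding Q_def by measurable

lemma AE_F: "AE v in F. v \<in> {0..vbar}"
  using F_supp by (subst F.AE_in_set_eq_1) auto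

lemma AE_G: "AE v in G. v \<in> {0..vbar}"
  using G_supp by (subst G.AE_in_set_eq_1) auto

lemma AE_round: "AE y in round. fst y \<in> {0..vbar} \<and> fst (snd y) \<in> {0..vbar}"
  unfolding round_def
proof (rule AE_conjI)
  show "AE y in F \<Otimes>\<^sub>M (G \<Otimes>\<^sub>M U). fst y \<in> {0..vbar}"
  proof (rule R.AE_pair_measure)
    show "{y \<in> space (F \<Otimes>\<^sub>M (G \<Otimes>\<^sub>M U)). fst y \<in> {0..vbar}} \<in> sets (F \<Otimes>\<^sub>M (G \<Otimes>\<^sub>M U))"
      by measurable
  qed (use AE_F in auto)
  have "AE z in G \<Otimes>\<^sub>M U. fst z \<in> {0..vbar}"
  proof (rule GU.AE_pair_measure)
    show "{z \<in> space (G \<Otimes>\<^sub>M U). fst z \<in> {0..vbar}} \<in> sets (G \<Otimes>\<^sub>M U)"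
      by measurable
  qed (use AE_G in auto)
  then show "AE y in F \<Otimes>\<^sub>M (G \<Otimes>\<^sub>M U). fst (snd y) \<in> {0..vbar}"
  proof (intro R.AE_pair_measure)
    show "{y \<in> space (F \<Otimes>\<^sub>M (G \<Otimes>\<^sub>M U)). fst (snd y) \<in> {0..vbar}} \<in> sets (F \<Otimes>\<^sub>M (G \<Otimes>\<^sub>M U))"
      by measurable
  qed auto
qed

text \<open>There are countably many rounds, so one null set serves all of them and every expected
  revenue can be computed with \<open>V\<close> and \<open>Q\<close>.\<close>

lemma AE_clip: "AE w in P. vv w = V w \<and> pp w = Q w"
proof -
  have "AE w in P. fst (w t) \<in> {0..vbar} \<and> fst (snd (w t)) \<in> {0..vbar}" for t
    unfolding P_eq by (rule AE_PiM_component[where M = "\<lambda>_. round", OF _ _ AE_round]) (auto simp: prob_round)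
  then have "AE w in P. \<forall>t. fst (w t) \<in> {0..vbar} \<and> fst (snd (w t)) \<in> {0..vbar}"
    unfolding AE_all_countable by blast
  then show ?thesis
    by (rule AE_mp) (auto simp: V_def Q_def clip_id vv_def pp_def fun_eq_iff)
qed

end

subsection \<open>Pathwise analysis of OGD-CB\<close>

lemma sum_list_bounds:
  assumes "\<And>q. q \<in> set qs \<Longrightarrow> 0 \<le> f q \<and> f q \<le> (u::real)"
  shows "0 \<le> (\<Sum>q\<leftarrow>qs. f q)" "(\<Sum>q\<leftarrow>qs. f q) \<le> real (length qs) * u"
  using assms by (induction qs) (auto simp: algebra_simps intro: add_mono)

lemma mean_bounds:
  assumes "\<And>q. q \<in> set qs \<Longrightarrow> 0 \<le> f q \<and> f q \<le> (u::real)" "0 \<le> u"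
  shows "0 \<le> (\<Sum>q\<leftarrow>qs. f q) / real (length qs)" "(\<Sum>q\<leftarrow>qs. f q) / real (length qs) \<le> u"
  using sum_list_bounds[of qs f u] assms
  by (auto simp: divide_le_eq mult.commute intro!: divide_nonneg_nonneg)

text \<open>A telescoping bound, later applied with \<open>n\<close> the random number of observed
  bids. The factor 3 comes from \<open>sqrt (n + 1) \<le> 2 * sqrt n\<close>.\<close>

lemma inverse_sqrt_le_diff:
  assumes "1 \<le> n" shows "1 / sqrt (real n) \<le> 3 * (sqrt (real (Suc n)) - sqrt (real n))"
proof -
  have n: "real n \<ge> 1" using assms by simp
  have "sqrt (real (Suc n)) \<le> sqrt (4 * real n)" using n by (intro real_sqrt_le_mono) simp
  then have le: "sqrt (real (Suc n)) + sqrt (real n) \<le> 3 * sqrt (real n)"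
    by (simp add: real_sqrt_mult)
  have "(sqrt (real (Suc n)) - sqrt (real n)) * (sqrt (real (Suc n)) + sqrt (real n)) = 1"
    by (simp add: algebra_simps flip: power2_eq_square)
  moreover have "0 < sqrt (real (Suc n)) + sqrt (real n)" using n by (intro add_pos_pos) auto
  ultimately have "sqrt (real (Suc n)) - sqrt (real n) = 1 / (sqrt (real (Suc n)) + sqrt (real n))"
    by (subst eq_divide_eq) auto
  also have "\<dots> \<ge> 1 / (3 * sqrt (real n))"
    using le n by (intro divide_left_mono mult_pos_pos add_pos_pos) auto
  finally show ?thesis by simp
qed

lemma inverse_le_ln_diff:
  assumes "1 \<le> n" shows "1 / real n \<le> 2 * (ln (real (Suc n)) - ln (real n))"
proof -
  have n: "real n \<ge> 1" using assms by simp
  have "ln (real n / real (Suc n)) \<le> real n / real (Suc n) - 1"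
    using n by (intro ln_le_minus_one) auto
  moreover have "ln (real n / real (Suc n)) = ln (real n) - ln (real (Suc n))"
    using n by (intro ln_divide_pos) auto
  moreover have "1 - real n / real (Suc n) \<ge> 1 / (2 * real n)"
    using n by (simp add: field_simps)
  ultimately have "ln (real (Suc n)) - ln (real n) \<ge> 1 / (2 * real n)" by linarith
  then show ?thesis by simp
qed

lemma sum_inverse_sqrt: "(\<Sum>t<m. 1 / sqrt (real (Suc t))) \<le> 2 * sqrt (real m)"
proof (induction m)
  case (Suc m)
  have "(sqrt (real (Suc m)) - sqrt (real m)) * (sqrt (real (Suc m)) + sqrt (real m)) = 1"
    by (simp add: algebra_simps flip: power2_eq_square)
  moreover have "0 < sqrt (real (Suc m)) + sqrt (real m)" by (intro add_pos_nonneg) auto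
  ultimately have "sqrt (real (Suc m)) - sqrt (real m) = 1 / (sqrt (real (Suc m)) + sqrt (real m))"
    by (subst eq_divide_eq) auto
  also have "\<dots> \<ge> 1 / (2 * sqrt (real (Suc m)))"
    by (intro divide_left_mono mult_pos_pos add_pos_nonneg) auto
  finally show ?case using Suc by simp
qed auto

locale ogd =
  fixes full :: bool and vbar rho :: real and T :: nat
  assumes vbar0: "0 < vbar" and rho0: "0 < rho" and rho_le: "rho \<le> vbar" and T_ge: "1 \<le> T"
begin

text \<open>Index \<open>t\<close> refers to round \<open>Suc t\<close> of the algorithm, whose input state is \<open>st v p t\<close>.\<close>

definition st :: "(nat \<Rightarrow> real) \<Rightarrow> (nat \<Rightarrow> real) \<Rightarrow> nat \<Rightarrow> ogd_st" where
  "st v p t = ogd_state full vbar rho T v p t"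

definition bids :: "(nat \<Rightarrow> real) \<Rightarrow> (nat \<Rightarrow> real) \<Rightarrow> nat \<Rightarrow> real list" where
  "bids v p t = fst (st v p t)"

definition lam :: "(nat \<Rightarrow> real) \<Rightarrow> (nat \<Rightarrow> real) \<Rightarrow> nat \<Rightarrow> real" where
  "lam v p t = fst (snd (st v p t))"

definition bud :: "(nat \<Rightarrow> real) \<Rightarrow> (nat \<Rightarrow> real) \<Rightarrow> nat \<Rightarrow> real" where
  "bud v p t = fst (snd (snd (st v p t)))"

definition act :: "(nat \<Rightarrow> real) \<Rightarrow> (nat \<Rightarrow> real) \<Rightarrow> nat \<Rightarrow> bool" where
  "act v p t \<longleftrightarrow> \<not> snd (snd (snd (st v p t)))"

definition X :: "(nat \<Rightarrow> real) \<Rightarrow> (nat \<Rightarrow> real) \<Rightarrow> nat \<Rightarrow> bool" where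
  "X v p t = ogd_x full vbar rho T v p (Suc t)"

definition ep :: "(nat \<Rightarrow> real) \<Rightarrow> (nat \<Rightarrow> real) \<Rightarrow> nat \<Rightarrow> real" where
  "ep v p t = ogd_eps T (length (bids v p t))"

definition ctil :: "(nat \<Rightarrow> real) \<Rightarrow> (nat \<Rightarrow> real) \<Rightarrow> nat \<Rightarrow> real" where
  "ctil v p t = ogd_c (bids v p t) (ep v p t) (v (Suc t))"

definition rtil :: "(nat \<Rightarrow> real) \<Rightarrow> (nat \<Rightarrow> real) \<Rightarrow> nat \<Rightarrow> real" where
  "rtil v p t = ogd_r (bids v p t) (ep v p t) (v (Suc t))"

lemmas st_defs = st_def bids_def lam_def bud_def act_def X_def ep_def ctil_def rtil_def

lemma init: "bids v p 0 = []" "lam v p 0 = 0" "bud v p 0 = rho * real T" "act v p 0"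
  by (simp_all add: st_defs)

lemma X_eq_dec: "X v p t = fst (ogd_dec vbar rho T (Suc t) (v (Suc t)) (st v p t))"
  by (simp add: X_def ogd_x_def st_def)

lemma dec_active:
  assumes "act v p t"
  shows "ogd_dec vbar rho T (Suc t) (v (Suc t)) (st v p t) =
    (if t = 0 then (True, lam v p t)
     else (lam v p t * ctil v p t \<le> rtil v p t,
       max 0 (lam v p t + 1 / (vbar * sqrt (real (Suc t))) *
         (of_bool (lam v p t * ctil v p t \<le> rtil v p t) * ctil v p t - rho))))"
  using assms unfolding ogd_dec_def Let_def act_def lam_def ctil_def rtil_def ep_def bids_def
  by simp

lemma dec_inactive:
  "\<not> act v p t \<Longrightarrow> ogd_dec vbar rho T (Suc t) (v (Suc t)) (st v p t) = (False, lam v p t)"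
  unfolding ogd_dec_def Let_def act_def lam_def by simp

lemma st_Suc_inactive: "\<not> act v p t \<Longrightarrow> st v p (Suc t) = st v p t"
  unfolding act_def st_def ogd_state.simps Let_def by simp

lemma st_Suc_active:
  assumes "act v p t"
  shows "st v p (Suc t) =
    (if full \<or> X v p t then bids v p t @ [p (Suc t)] else bids v p t,
     snd (ogd_dec vbar rho T (Suc t) (v (Suc t)) (st v p t)),
     bud v p t - of_bool (X v p t) * cst (v (Suc t)) (p (Suc t)),
     bud v p t - of_bool (X v p t) * cst (v (Suc t)) (p (Suc t)) < vbar)"
proof -
  have "\<not> snd (snd (snd (ogd_state full vbar rho T v p t)))" using assms by (simp add: act_def st_def)
  then show ?thesis
    unfolding X_eq_dec bids_def bud_def st_def ogd_state.simps Let_def by simp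
qed

lemma step_inactive:
  assumes "\<not> act v p t"
  shows "\<not> X v p t" "bids v p (Suc t) = bids v p t" "lam v p (Suc t) = lam v p t"
    "bud v p (Suc t) = bud v p t" "\<not> act v p (Suc t)"
  using assms st_Suc_inactive[OF assms]
  by (simp_all add: X_eq_dec dec_inactive bids_def lam_def bud_def act_def)

lemma X_act: "X v p t \<Longrightarrow> act v p t"
  using step_inactive by blast

lemma X_first: "X v p 0"
  by (simp add: X_eq_dec dec_active init)

lemma X_eq: "1 \<le> t \<Longrightarrow> X v p t \<longleftrightarrow> act v p t \<and> lam v p t * ctil v p t \<le> rtil v p t"
  by (cases "act v p t") (simp_all add: X_eq_dec dec_active dec_inactive)

lemma lam_first: "lam v p (Suc 0) = 0"
proof -
  have "lam v p (Suc 0) = snd (ogd_dec vbar rho T (Suc 0) (v (Suc 0)) (st v p 0))"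
    unfolding lam_def st_Suc_active[OF init(4)] by simp
  then show ?thesis by (simp add: dec_active init)
qed

lemma lam_step:
  assumes "1 \<le> t" "act v p t"
  shows "lam v p (Suc t) =
    max 0 (lam v p t + 1 / (vbar * sqrt (real (Suc t))) * (of_bool (X v p t) * ctil v p t - rho))"
proof -
  have "lam v p (Suc t) = snd (ogd_dec vbar rho T (Suc t) (v (Suc t)) (st v p t))"
    unfolding lam_def[of v p "Suc t"] st_Suc_active[OF assms(2)] by simp
  then show ?thesis using assms by (simp add: dec_active X_eq)
qed

lemma bids_step:
  "bids v p (Suc t) = (if act v p t \<and> (full \<or> X v p t) then bids v p t @ [p (Suc t)] else bids v p t)"
proof (cases "act v p t")
  case True
  then show ?thesis unfolding bids_def[of v p "Suc t"] st_Suc_active[OF True] by simp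
qed (simp add: step_inactive)

lemma bud_step: "bud v p (Suc t) = bud v p t - of_bool (X v p t) * cst (v (Suc t)) (p (Suc t))"
proof (cases "act v p t")
  case True
  then show ?thesis unfolding bud_def[of v p "Suc t"] st_Suc_active[OF True] by simp
qed (simp add: step_inactive)

lemma act_step: "act v p (Suc t) \<longleftrightarrow> act v p t \<and> vbar \<le> bud v p (Suc t)"
proof (cases "act v p t")
  case True
  then show ?thesis unfolding bud_step act_def[of v p "Suc t"] st_Suc_active[OF True]
    by (simp add: not_less)
qed (simp add: step_inactive)

lemma rev_eq: "ogd_rev full vbar rho v p T = (\<Sum>t<T. of_bool (X v p t) * rwd (v (Suc t)) (p (Suc t)))"
  unfolding ogd_rev_def X_def
  by (rule sum.reindex_bij_witness[where i = Suc and j = "\<lambda>t. t - 1"]) auto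

lemma ogd_state_cong:
  assumes "\<And>s. s \<in> {1..t} \<Longrightarrow> v s = v' s \<and> p s = p' s"
  shows "ogd_state full vbar rho T v p t = ogd_state full vbar rho T v' p' t"
  using assms
proof (induction t)
  case (Suc t)
  then have "ogd_state full vbar rho T v p t = ogd_state full vbar rho T v' p' t" by simp
  moreover have "v (Suc t) = v' (Suc t)" "p (Suc t) = p' (Suc t)" using Suc.prems[of "Suc t"] by auto
  ultimately show ?case unfolding ogd_state.simps by (simp only:)
qed simp

text \<open>The state at index \<open>t\<close> is determined by rounds 1 to \<open>t\<close>; the
  decision of round \<open>Suc t\<close> sees in addition the value of that round but not its bid
  (\<open>X_cong\<close>). All independence used for OGD-CB rests on these two facts.\<close>

lemma state_cong:
  assumes "\<And>s. s \<in> {1..t} \<Longrightarrow> v s = v' s \<and> p s = p' s"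
  shows "bids v p t = bids v' p' t" "lam v p t = lam v' p' t" "act v p t = act v' p' t"
    "ep v p t = ep v' p' t"
  using ogd_state_cong[OF assms] by (simp_all add: st_defs)

lemma X_cong:
  assumes "\<And>s. s \<in> {1..t} \<Longrightarrow> v s = v' s \<and> p s = p' s" "v (Suc t) = v' (Suc t)"
  shows "X v p t = X v' p' t" "ctil v p t = ctil v' p' t"
  using ogd_state_cong[OF assms(1)] assms(2) by (simp_all add: st_defs ogd_x_def)

lemma ep_nonneg: "0 \<le> ep v p t"
  using T_ge by (auto simp: ep_def ogd_eps_def intro!: divide_nonneg_nonneg)

lemma act_mono: "act v p t \<Longrightarrow> s \<le> t \<Longrightarrow> act v p s"
  by (induction t) (auto simp: le_Suc_eq act_step)

lemma length_bids_le: "length (bids v p t) \<le> t"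
  by (induction t) (auto simp: init bids_step)

lemma length_bids_step: "length (bids v p t) + of_bool (X v p t) \<le> length (bids v p (Suc t))"
  using X_act[of v p t] by (auto simp: bids_step)

lemma length_bids_pos: "1 \<le> t \<Longrightarrow> 1 \<le> length (bids v p t)"
proof (induction t rule: dec_induct)
  case base
  show ?case using length_bids_step[of v p 0] X_first[of v p] by (simp add: init)
next
  case (step t)
  then show ?case using length_bids_step[of v p t] by simp
qed

text \<open>Under either kind of feedback a round with \<open>X\<close> lengthens the list of bids,
  so its summand is dominated by an increment of \<open>3 * sqrt\<close> of the length. For
  \<open>t = 0\<close> the list is empty and the summand is 0 because
  \<open>1 / 0 = 0\<close>.\<close>

lemma sum_X_inverse_sqrt:
  "(\<Sum>t<m. of_bool (X v p t) * (1 / sqrt (real (length (bids v p t))))) \<le> 3 * sqrt (real (length (bids v p m)))"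
proof (induction m)
  case (Suc m)
  let ?n = "length (bids v p m)"
  have "of_bool (X v p m) * (1 / sqrt (real ?n)) \<le> 3 * (sqrt (real (length (bids v p (Suc m)))) - sqrt (real ?n))"
  proof (cases "X v p m \<and> 1 \<le> ?n")
    case True
    have "sqrt (real (Suc ?n)) \<le> sqrt (real (length (bids v p (Suc m))))"
      using length_bids_step[of v p m] True by (intro real_sqrt_le_mono) simp
    moreover have "1 / sqrt (real ?n) \<le> 3 * (sqrt (real (Suc ?n)) - sqrt (real ?n))"
      using inverse_sqrt_le_diff True by blast
    moreover have "of_bool (X v p m) * (1 / sqrt (real ?n)) = 1 / sqrt (real ?n)" using True by simp
    ultimately show ?thesis by (simp only:) argo
  next
    case False
    have "real ?n \<le> real (length (bids v p (Suc m)))" using length_bids_step[of v p m] by simp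
    then have "sqrt (real ?n) \<le> sqrt (real (length (bids v p (Suc m))))" by simp
    moreover have 0: "of_bool (X v p m) * (1 / sqrt (real ?n)) = 0"
      using False by (auto simp: Suc_le_eq)
    ultimately show ?thesis unfolding 0 by simp
  qed
  with Suc show ?case by simp
qed (simp add: init)

lemma sum_X_inverse:
  "(\<Sum>t<m. of_bool (X v p t) * (1 / real (length (bids v p t)))) \<le> 2 * ln (real (length (bids v p m)))"
proof (induction m)
  case (Suc m)
  let ?n = "length (bids v p m)"
  have "of_bool (X v p m) * (1 / real ?n) \<le> 2 * (ln (real (length (bids v p (Suc m)))) - ln (real ?n))"
  proof (cases "1 \<le> ?n")
    case True
    show ?thesis
    proof (cases "X v p m")
      case x: True
      then have "ln (real (Suc ?n)) \<le> ln (real (length (bids v p (Suc m))))"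
        using length_bids_step[of v p m] by (subst ln_le_cancel_iff) auto
      then have "1 / real ?n \<le> 2 * (ln (real (length (bids v p (Suc m)))) - ln (real ?n))"
        using inverse_le_ln_diff[OF True] by argo
      then show ?thesis using x by simp
    next
      case False
      have "ln (real ?n) \<le> ln (real (length (bids v p (Suc m))))"
        using length_bids_step[of v p m] True by (subst ln_le_cancel_iff) auto
      then show ?thesis using False by simp
    qed
  next
    case False
    \<comment> \<open>The list is empty only before round 1, where the conventions
      \<open>1 / 0 = 0\<close> and \<open>ln 0 = 0\<close> make both sides 0.\<close>
    then have m: "m = 0" using length_bids_pos[of m v p] by (cases m; simp)
    have l: "length (bids v p (Suc 0)) = 1"
      using length_bids_le[of v p "Suc 0"] length_bids_pos[of "Suc 0" v p] by simp
    show ?thesis unfolding m l init by simp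
  qed
  with Suc show ?case by simp
qed (simp add: init)

text \<open>The largest level from which the multiplier can still rise, plus 1 for the largest
  possible step.\<close>

definition Lam :: real where "Lam = 3 * vbar / (2 * rho) + 1"

text \<open>Twice the number of observations times the squared confidence width. The value
  \<open>exp (- A) = 1 / (2 * T^2)\<close> is the failure probability allotted to one sign of the
  deviation and one number of observations.\<close>

definition A :: real where "A = ln 2 + 2 * ln (real T)"

lemma A_nonneg: "0 \<le> A"
  using T_ge by (simp add: A_def)

text \<open>The direction in which the dual update moves. It is 0 in round 1 and after stopping,
  when the multiplier is frozen.\<close>

definition drift :: "(nat \<Rightarrow> real) \<Rightarrow> (nat \<Rightarrow> real) \<Rightarrow> nat \<Rightarrow> real" where
  "drift v p t = (if act v p t \<and> 1 \<le> t then of_bool (X v p t) * ctil v p t - rho else 0)"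

text \<open>The width is scaled by the value because reward and cost of a round lie between 0 and
  the value. \<open>rb\<close> and \<open>cb\<close> stay abstract, which keeps the pathwise
  analysis deterministic; they become the conditional means over the bid.\<close>

definition bad :: "(real \<Rightarrow> real) \<Rightarrow> (real \<Rightarrow> real) \<Rightarrow> (nat \<Rightarrow> real) \<Rightarrow> (nat \<Rightarrow> real) \<Rightarrow> nat \<Rightarrow> bool" where
  "bad rb cb v p t \<longleftrightarrow> 1 \<le> t \<and> (
     \<not> \<bar>(\<Sum>q\<leftarrow>bids v p t. rwd (v (Suc t)) q) / real (length (bids v p t)) - rb (v (Suc t))\<bar> \<le> ep v p t * v (Suc t) \<or>
     \<not> \<bar>(\<Sum>q\<leftarrow>bids v p t. cst (v (Suc t)) q) / real (length (bids v p t)) - cb (v (Suc t))\<bar> \<le> ep v p t * v (Suc t))"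

text \<open>The deterministic part of the loss bound; the remaining terms of \<open>total_loss_le\<close> are random.\<close>

definition slack :: real where
  "slack = vbar / 2 * Lam\<^sup>2 * sqrt (real T) + 2 * vbar * sqrt (real T) + 4 * vbar * A * ln (real T)
    + vbar / rho * (2 * vbar + Lam * vbar * sqrt (real T) + 9 * vbar * sqrt (A / 2) * sqrt (real T))"

lemma Lam_pos: "0 < Lam"
  using vbar0 rho0 by (simp add: Lam_def add_nonneg_pos)

context
  fixes v p :: "nat \<Rightarrow> real"
  assumes v: "\<And>t. 0 \<le> v t \<and> v t \<le> vbar" and p: "\<And>t. 0 \<le> p t \<and> p t \<le> vbar"
begin

lemma bids_bounds: "q \<in> set (bids v p t) \<Longrightarrow> 0 \<le> q \<and> q \<le> vbar"
  by (induction t) (use p in \<open>auto simp: init bids_step split: if_splits\<close>)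

lemma ctil_bounds:
  "- 2 * ep v p t * v (Suc t) \<le> ctil v p t" "ctil v p t \<le> v (Suc t) - 2 * ep v p t * v (Suc t)"
  unfolding ctil_def ogd_c_def
  using mean_bounds[of "bids v p t" "cst (v (Suc t))" "v (Suc t)"] bids_bounds v cst_bounds by auto

lemma rtil_bounds:
  "ep v p t * v (Suc t) \<le> rtil v p t" "rtil v p t \<le> v (Suc t) + ep v p t * v (Suc t)"
  unfolding rtil_def ogd_r_def
  using mean_bounds[of "bids v p t" "rwd (v (Suc t))" "v (Suc t)"] bids_bounds v rwd_bounds by auto

text \<open>The multiplier rises only if \<open>X\<close> holds and \<open>ctil > rho\<close>. As
  \<open>ctil\<close> is then positive, the scaled width is at most half the value, so
  \<open>rtil \<le> 3 * vbar / 2\<close>, and participation gives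
  \<open>lam * rho \<le> lam * ctil \<le> rtil\<close>. One step adds at most 1, since the step size
  times \<open>vbar\<close> is at most 1.\<close>

lemma lam_bounds: "0 \<le> lam v p t \<and> lam v p t \<le> Lam"
proof (induction t)
  case 0
  show ?case using Lam_pos by (simp add: init)
next
  case (Suc t)
  show ?case
  proof (cases "t = 0 \<or> \<not> act v p t")
    case True
    then show ?thesis using Suc Lam_pos by (auto simp: lam_first step_inactive)
  next
    case False
    then have t: "1 \<le> t" and a: "act v p t" by auto
    define eta where "eta = 1 / (vbar * sqrt (real (Suc t)))"
    have eta: "0 \<le> eta" "eta * vbar \<le> 1" using vbar0 by (auto simp: eta_def field_simps)
    have step: "lam v p (Suc t) = max 0 (lam v p t + eta * (of_bool (X v p t) * ctil v p t - rho))"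
      using lam_step[OF t a] by (simp add: eta_def)
    show ?thesis
    proof (cases "of_bool (X v p t) * ctil v p t \<le> rho")
      case True
      then have "eta * (of_bool (X v p t) * ctil v p t - rho) \<le> 0"
        using eta by (simp add: mult_nonneg_nonpos)
      then show ?thesis using Suc Lam_pos unfolding step by auto
    next
      case False
      then have x: "X v p t" and gt: "rho < ctil v p t" using rho0 by (cases "X v p t"; simp)+
      have half: "ep v p t * v (Suc t) \<le> v (Suc t) / 2"
        using ctil_bounds(2)[of t] gt rho0 by (simp add: algebra_simps)
      have "lam v p t * rho \<le> lam v p t * ctil v p t"
        using gt Suc by (intro mult_left_mono) auto
      also have "\<dots> \<le> rtil v p t" using x X_eq[OF t] by blast
      also have "\<dots> \<le> 3 * vbar / 2" using rtil_bounds(2)[of t] half v[of "Suc t"] by linarith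
      finally have "lam v p t \<le> 3 * vbar / (2 * rho)" using rho0 by (simp add: field_simps)
      moreover have "eta * (ctil v p t - rho) \<le> 1"
      proof -
        have "ctil v p t \<le> v (Suc t)"
          using ctil_bounds(2)[of t] mult_nonneg_nonneg[OF ep_nonneg[of v p t], of "v (Suc t)"] v[of "Suc t"] by linarith
        then have "eta * (ctil v p t - rho) \<le> eta * vbar"
          using v[of "Suc t"] rho0 eta by (intro mult_left_mono) auto
        then show ?thesis using eta by linarith
      qed
      ultimately show ?thesis using Lam_pos x unfolding step Lam_def by auto
    qed
  qed
qed

lemma bud_eq: "bud v p t = rho * real T - (\<Sum>s<t. of_bool (X v p s) * cst (v (Suc s)) (p (Suc s)))"
  by (induction t) (auto simp: init bud_step)

lemma bud_inactive: "\<not> act v p t \<Longrightarrow> bud v p t < vbar"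
proof (induction t)
  case (Suc t)
  then show ?case
    by (cases "act v p t") (auto simp: act_step bud_step step_inactive)
qed (simp add: init)

text \<open>Truncation at 0 only increases the multiplier, so \<open>drift\<close> is at most its
  increment times \<open>vbar * sqrt (Suc t)\<close>. Summation by parts with these growing weights
  leaves only the last multiplier, as multipliers are nonnegative.\<close>

lemma sum_drift: "(\<Sum>s<t. drift v p s) \<le> lam v p t * (vbar * sqrt (real t))"
proof (induction t)
  case (Suc t)
  have mono: "lam v p t * (vbar * sqrt (real t)) \<le> lam v p t * (vbar * sqrt (real (Suc t)))"
    using lam_bounds[of t] vbar0 by (intro mult_left_mono) auto
  show ?case
  proof (cases "act v p t \<and> 1 \<le> t")
    case True
    define c where "c = vbar * sqrt (real (Suc t))"
    have c: "0 < c" using vbar0 by (simp add: c_def)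
    have "lam v p t + 1 / c * drift v p t \<le> lam v p (Suc t)"
      using lam_step[of t v p] True by (simp add: drift_def c_def)
    then have "c * (lam v p t + 1 / c * drift v p t) \<le> c * lam v p (Suc t)"
      using c by (intro mult_left_mono) auto
    then have "drift v p t \<le> (lam v p (Suc t) - lam v p t) * c"
      using c by (simp add: algebra_simps)
    then show ?thesis using Suc mono by (simp add: c_def algebra_simps)
  next
    case False
    then have "drift v p t = 0" "lam v p (Suc t) = lam v p t \<or> t = 0"
      using step_inactive by (auto simp: drift_def)
    then show ?thesis using Suc mono lam_bounds[of "Suc t"] vbar0 by (auto simp: init)
  qed
qed (simp add: init)

text \<open>This is \<open>(a + b)^2 \<le> 2 * (a^2 + b^2)\<close>. The width is kept explicit: it
  can be of order \<open>sqrt (ln T)\<close> while few bids are known, and inserting this worst case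
  in every round would give regret of order \<open>sqrt T * ln T\<close>.\<close>

lemma drift_sq_le:
  "(drift v p t)\<^sup>2 \<le> 2 * vbar\<^sup>2 * (1 + 4 * of_bool (X v p t) * (ep v p t)\<^sup>2)"
proof -
  let ?x = "of_bool (X v p t) :: real"
  let ?e = "ep v p t * v (Suc t)"
  have e: "0 \<le> ?e" "?e \<le> ep v p t * vbar"
    using v[of "Suc t"] ep_nonneg[of v p t] by (auto intro: mult_left_mono)
  have "\<bar>drift v p t\<bar> \<le> vbar + 2 * (?x * (ep v p t * vbar))"
    using ctil_bounds[of t] v[of "Suc t"] rho_le rho0 e vbar0
    by (cases "X v p t") (auto simp: drift_def)
  then have "\<bar>drift v p t\<bar> \<le> vbar * (1 + 2 * ?x * ep v p t)" by (simp add: algebra_simps)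
  then have "\<bar>drift v p t\<bar>\<^sup>2 \<le> (vbar * (1 + 2 * ?x * ep v p t))\<^sup>2" by (intro power_mono) auto
  also have "\<dots> = vbar\<^sup>2 * (1 + 2 * ?x * ep v p t)\<^sup>2" by (simp add: power_mult_distrib)
  also have "\<dots> \<le> vbar\<^sup>2 * (2 * (1 + 4 * ?x * (ep v p t)\<^sup>2))"
  proof (rule mult_left_mono)
    have "0 \<le> (1 - 2 * ?x * ep v p t)\<^sup>2" by simp
    then show "(1 + 2 * ?x * ep v p t)\<^sup>2 \<le> 2 * (1 + 4 * ?x * (ep v p t)\<^sup>2)"
      by (cases "X v p t") (auto simp: power2_eq_square algebra_simps)
  qed simp
  finally show ?thesis by (simp add: algebra_simps)
qed

text \<open>Regret of online gradient descent against the comparator 0. The shrinking step size puts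
  a growing weight \<open>sqrt t\<close> on the potential; measuring the potential as
  \<open>Lam^2 - lam^2\<close>, which is nonnegative, makes the growth of the weight go in the right
  direction.\<close>

lemma regret_dual:
  "(\<Sum>s<t. - (lam v p s * drift v p s)) \<le> vbar / 2 * (Lam\<^sup>2 - (lam v p t)\<^sup>2) * sqrt (real t)
     + (\<Sum>s<t. vbar / sqrt (real (Suc s)) * (1 + 4 * of_bool (X v p s) * (ep v p s)\<^sup>2))"
proof (induction t)
  case (Suc t)
  define c where "c = vbar * sqrt (real (Suc t))"
  have c: "0 < c" using vbar0 by (simp add: c_def)
  let ?D = "vbar / sqrt (real (Suc t)) * (1 + 4 * of_bool (X v p t) * (ep v p t)\<^sup>2)"
  have D: "0 \<le> ?D" using vbar0 by auto
  have sq: "(lam v p t)\<^sup>2 \<le> Lam\<^sup>2" for t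
    using lam_bounds[of t] by (intro power_mono) auto
  have mono: "vbar / 2 * (Lam\<^sup>2 - (lam v p t)\<^sup>2) * sqrt (real t) \<le> vbar / 2 * (Lam\<^sup>2 - (lam v p t)\<^sup>2) * sqrt (real (Suc t))"
    using sq[of t] vbar0 by (intro mult_left_mono) auto
  show ?case
  proof (cases "act v p t \<and> 1 \<le> t")
    case True
    have "lam v p (Suc t) = max 0 (lam v p t + 1 / c * drift v p t)"
      using lam_step[of t v p] True by (simp add: drift_def c_def)
    then have "(lam v p (Suc t))\<^sup>2 \<le> (lam v p t + 1 / c * drift v p t)\<^sup>2"
      by (auto simp: max_def)
    then have "(lam v p (Suc t))\<^sup>2 \<le> (lam v p t)\<^sup>2 + 2 / c * lam v p t * drift v p t + (drift v p t)\<^sup>2 / c\<^sup>2"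
      by (simp add: power2_eq_square algebra_simps add_divide_distrib)
    then have "c / 2 * (lam v p (Suc t))\<^sup>2 \<le> c / 2 * ((lam v p t)\<^sup>2 + 2 / c * lam v p t * drift v p t + (drift v p t)\<^sup>2 / c\<^sup>2)"
      using c by (intro mult_left_mono) auto
    also have "\<dots> = c / 2 * (lam v p t)\<^sup>2 + lam v p t * drift v p t + (drift v p t)\<^sup>2 / (2 * c)"
      using c by (simp add: field_simps power2_eq_square)
    finally have 1: "- (lam v p t * drift v p t) \<le> c / 2 * ((lam v p t)\<^sup>2 - (lam v p (Suc t))\<^sup>2) + (drift v p t)\<^sup>2 / (2 * c)"
      by (simp add: algebra_simps)
    have "(drift v p t)\<^sup>2 / (2 * c) \<le> 2 * vbar\<^sup>2 * (1 + 4 * of_bool (X v p t) * (ep v p t)\<^sup>2) / (2 * c)"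
      using drift_sq_le[of t] c by (intro divide_right_mono) auto
    also have "\<dots> = ?D" using vbar0 by (simp add: c_def power2_eq_square)
    finally have "- (lam v p t * drift v p t) \<le> c / 2 * ((lam v p t)\<^sup>2 - (lam v p (Suc t))\<^sup>2) + ?D"
      using 1 by linarith
    moreover have "vbar / 2 * (Lam\<^sup>2 - (lam v p t)\<^sup>2) * sqrt (real (Suc t)) + c / 2 * ((lam v p t)\<^sup>2 - (lam v p (Suc t))\<^sup>2)
        = vbar / 2 * (Lam\<^sup>2 - (lam v p (Suc t))\<^sup>2) * sqrt (real (Suc t))"
      by (simp add: c_def algebra_simps)
    ultimately show ?thesis using Suc mono unfolding sum.lessThan_Suc by linarith
  next
    case False
    then have "drift v p t = 0" "lam v p (Suc t) = lam v p t"
      using step_inactive lam_first by (auto simp: drift_def init not_le)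
    then show ?thesis using Suc mono D by simp
  qed
qed (simp add: init)

lemma sum_X_ep: "(\<Sum>t<T. of_bool (X v p t) * ep v p t) \<le> 3 * sqrt (A / 2) * sqrt (real T)"
proof -
  have "(\<Sum>t<T. of_bool (X v p t) * ep v p t)
      = sqrt (A / 2) * (\<Sum>t<T. of_bool (X v p t) * (1 / sqrt (real (length (bids v p t)))))"
    unfolding sum_distrib_left
    by (intro sum.cong refl) (simp add: ep_def ogd_eps_def A_def real_sqrt_divide real_sqrt_mult)
  also have "\<dots> \<le> sqrt (A / 2) * (3 * sqrt (real (length (bids v p T))))"
    using A_nonneg by (intro mult_left_mono sum_X_inverse_sqrt) auto
  also have "\<dots> \<le> sqrt (A / 2) * (3 * sqrt (real T))"
    using A_nonneg length_bids_le[of v p T] by (intro mult_left_mono real_sqrt_le_mono) auto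
  finally show ?thesis by (simp add: mult_ac)
qed

lemma sum_X_ep_sq: "(\<Sum>t<T. of_bool (X v p t) * (ep v p t)\<^sup>2) \<le> A * ln (real T)"
proof -
  have "(\<Sum>t<T. of_bool (X v p t) * (ep v p t)\<^sup>2)
      = A / 2 * (\<Sum>t<T. of_bool (X v p t) * (1 / real (length (bids v p t))))"
    unfolding sum_distrib_left using A_nonneg
    by (intro sum.cong refl) (auto simp: ep_def ogd_eps_def A_def[symmetric])
  also have "\<dots> \<le> A / 2 * (2 * ln (real (length (bids v p T))))"
    using A_nonneg by (intro mult_left_mono sum_X_inverse) auto
  also have "\<dots> \<le> A / 2 * (2 * ln (real T))"
    using A_nonneg length_bids_le[of v p T] length_bids_pos[OF T_ge, of v p]
    by (intro mult_left_mono) (auto intro!: ln_mono)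
  finally show ?thesis by simp
qed

text \<open>In front of the squared widths the factor \<open>1 / sqrt (Suc s)\<close> is simply
  bounded by 1, because their sum has order \<open>(ln T)^2\<close> already.\<close>

lemma sum_regret_terms:
  "(\<Sum>s<T. vbar / sqrt (real (Suc s)) * (1 + 4 * of_bool (X v p s) * (ep v p s)\<^sup>2))
     \<le> 2 * vbar * sqrt (real T) + 4 * vbar * A * ln (real T)"
proof -
  have "(\<Sum>s<T. vbar / sqrt (real (Suc s)) * (1 + 4 * of_bool (X v p s) * (ep v p s)\<^sup>2))
      \<le> (\<Sum>s<T. vbar * (1 / sqrt (real (Suc s))) + 4 * vbar * (of_bool (X v p s) * (ep v p s)\<^sup>2))"
  proof (rule sum_mono)
    fix s
    have "1 / sqrt (real (Suc s)) \<le> 1" by simp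
    then have "1 / sqrt (real (Suc s)) * (4 * vbar * (of_bool (X v p s) * (ep v p s)\<^sup>2))
        \<le> 1 * (4 * vbar * (of_bool (X v p s) * (ep v p s)\<^sup>2))"
      using vbar0 by (intro mult_right_mono) auto
    then show "vbar / sqrt (real (Suc s)) * (1 + 4 * of_bool (X v p s) * (ep v p s)\<^sup>2)
        \<le> vbar * (1 / sqrt (real (Suc s))) + 4 * vbar * (of_bool (X v p s) * (ep v p s)\<^sup>2)"
      by (simp add: algebra_simps)
  qed
  also have "\<dots> = vbar * (\<Sum>s<T. 1 / sqrt (real (Suc s))) + 4 * vbar * (\<Sum>s<T. of_bool (X v p s) * (ep v p s)\<^sup>2)"
    by (simp only: sum.distrib sum_distrib_left)
  also have "\<dots> \<le> vbar * (2 * sqrt (real T)) + 4 * vbar * (A * ln (real T))"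
    using vbar0 by (intro add_mono mult_left_mono sum_inverse_sqrt sum_X_ep_sq) auto
  finally show ?thesis by simp
qed

text \<open>Optimism: in a good round \<open>rb \<le> rtil\<close> and \<open>ctil \<le> cb\<close>.
  A skipped round then has \<open>rb \<le> rtil < lam * ctil \<le> lam * cb\<close>, and a taken one
  has \<open>0 \<le> lam * (cb - ctil)\<close>. The resulting bound is split at \<open>rho\<close>
  into a term to be averaged over the value and a term for the dual regret.\<close>

lemma loss_le:
  assumes rb: "0 \<le> rb (v (Suc t)) \<and> rb (v (Suc t)) \<le> v (Suc t)"
    and cb: "0 \<le> cb (v (Suc t)) \<and> cb (v (Suc t)) \<le> v (Suc t)"
  shows "of_bool (\<not> X v p t) * rb (v (Suc t)) \<le>
    of_bool (act v p t) * lam v p t * (cb (v (Suc t)) - rho) + - (lam v p t * drift v p t)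
    + (1 + Lam) * vbar * of_bool (bad rb cb v p t) + vbar * of_bool (\<not> act v p t)"
proof -
  have Lv: "0 \<le> (1 + Lam) * vbar" using Lam_pos vbar0 by simp
  have l: "0 \<le> lam v p t" "lam v p t \<le> Lam" using lam_bounds by auto
  have vt: "0 \<le> v (Suc t)" "v (Suc t) \<le> vbar" using v by auto
  have ev: "0 \<le> ep v p t * v (Suc t)" using ep_nonneg vt by simp
  consider "t = 0" | "1 \<le> t" "\<not> act v p t" | "1 \<le> t" "act v p t" by fastforce
  then show ?thesis
  proof cases
    case 1
    then show ?thesis using Lv by (simp add: X_first init)
  next
    case 2
    then show ?thesis using Lv rb vt by (simp add: drift_def)
  next
    case 3
    have key: "of_bool (\<not> X v p t) * rb (v (Suc t)) \<le>
      lam v p t * (cb (v (Suc t)) - of_bool (X v p t) * ctil v p t) + (1 + Lam) * vbar * of_bool (bad rb cb v p t)"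
    proof (cases "bad rb cb v p t")
      case True
      have "ctil v p t \<le> vbar" using ctil_bounds(2)[of t] vt ev by linarith
      then have "- vbar \<le> cb (v (Suc t)) - of_bool (X v p t) * ctil v p t"
        using cb vbar0 by (cases "X v p t") auto
      then have "lam v p t * (- vbar) \<le> lam v p t * (cb (v (Suc t)) - of_bool (X v p t) * ctil v p t)"
        using l by (intro mult_left_mono) auto
      moreover have "lam v p t * vbar \<le> Lam * vbar" using l vbar0 by (intro mult_right_mono) auto
      moreover have "of_bool (\<not> X v p t) * rb (v (Suc t)) \<le> vbar"
        using rb vt by (cases "X v p t") auto
      ultimately show ?thesis using True by (simp add: algebra_simps)
    next
      case False
      then have g: "\<bar>(\<Sum>q\<leftarrow>bids v p t. rwd (v (Suc t)) q) / real (length (bids v p t)) - rb (v (Suc t))\<bar> \<le> ep v p t * v (Suc t)"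
        "\<bar>(\<Sum>q\<leftarrow>bids v p t. cst (v (Suc t)) q) / real (length (bids v p t)) - cb (v (Suc t))\<bar> \<le> ep v p t * v (Suc t)"
        using 3 by (auto simp: bad_def)
      have r: "rb (v (Suc t)) \<le> rtil v p t" using g(1) by (simp add: rtil_def ogd_r_def)
      have c: "ctil v p t \<le> cb (v (Suc t))" using g(2) ev by (simp add: ctil_def ogd_c_def)
      have "lam v p t * ctil v p t \<le> lam v p t * cb (v (Suc t))" using c l by (intro mult_left_mono)
      then show ?thesis using False r X_eq[OF 3(1), of v p] 3(2)
        by (cases "X v p t") (auto simp: algebra_simps)
    qed
    then show ?thesis using 3 by (simp add: drift_def algebra_simps)
  qed
qed

text \<open>\<open>ctil\<close> is the empirical mean less two scaled widths, and in a good round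
  that mean is at most one width below \<open>cb\<close>; hence the factor 3. Round 1 has no
  estimate and is charged \<open>vbar\<close>.\<close>

lemma cost_le:
  assumes cb: "0 \<le> cb (v (Suc t)) \<and> cb (v (Suc t)) \<le> v (Suc t)"
  shows "of_bool (X v p t) * cb (v (Suc t)) \<le> drift v p t + rho * of_bool (act v p t)
    + 3 * vbar * (of_bool (X v p t) * ep v p t) + vbar * of_bool (bad rb cb v p t) + vbar * of_bool (t = 0)"
proof -
  have vt: "0 \<le> v (Suc t)" "v (Suc t) \<le> vbar" using v by auto
  have ev: "0 \<le> ep v p t * v (Suc t)" "ep v p t * v (Suc t) \<le> ep v p t * vbar"
    using ep_nonneg vt by (auto intro: mult_left_mono)
  have ev0: "0 \<le> ep v p t * vbar" using ev by linarith
  consider "t = 0" | "1 \<le> t" "\<not> X v p t" | "1 \<le> t" "X v p t" by fastforce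
  then show ?thesis
  proof cases
    case 1
    then show ?thesis using ev0 cb vt vbar0 rho0 by (simp add: X_first init drift_def mult_ac)
  next
    case 2
    then show ?thesis using vbar0 by (simp add: drift_def)
  next
    case 3
    have "cb (v (Suc t)) \<le> ctil v p t + 3 * (ep v p t * vbar) + vbar * of_bool (bad rb cb v p t)"
    proof (cases "bad rb cb v p t")
      case True
      then show ?thesis using ctil_bounds(1)[of t] cb ev vt by simp
    next
      case False
      then have "\<bar>(\<Sum>q\<leftarrow>bids v p t. cst (v (Suc t)) q) / real (length (bids v p t)) - cb (v (Suc t))\<bar> \<le> ep v p t * v (Suc t)"
        using 3 by (auto simp: bad_def)
      then show ?thesis using False ev by (simp add: ctil_def ogd_c_def)
    qed
    then show ?thesis using 3 X_act[OF 3(2)] by (simp add: drift_def mult_ac)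
  qed
qed

text \<open>If the algorithm stops, less than \<open>vbar\<close> of the budget is left, so more
  than \<open>rho * T - vbar\<close> has been spent. By \<open>cost_le\<close> the spending is
  \<open>rho\<close> per active round plus errors, and the difference is \<open>rho\<close> per idle
  round. The other \<open>vbar\<close> stems from round 1.\<close>

lemma idle_le:
  assumes cb: "\<And>u. 0 \<le> u \<Longrightarrow> u \<le> vbar \<Longrightarrow> 0 \<le> cb u \<and> cb u \<le> u"
  shows "rho * (\<Sum>t<T. of_bool (\<not> act v p t)) \<le> 2 * vbar
    + \<bar>\<Sum>t<T. of_bool (X v p t) * (cst (v (Suc t)) (p (Suc t)) - cb (v (Suc t)))\<bar>
    + Lam * vbar * sqrt (real T) + 9 * vbar * sqrt (A / 2) * sqrt (real T)
    + vbar * (\<Sum>t<T. of_bool (bad rb cb v p t))"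
    (is "_ \<le> _ + \<bar>?M\<bar> + _ + _ + ?B")
proof (cases "act v p T")
  case True
  then have "(\<Sum>t<T. of_bool (\<not> act v p t)) = (0::real)"
    using act_mono[OF True] by (intro sum.neutral) auto
  moreover have "0 \<le> Lam * vbar * sqrt (real T)" "0 \<le> 9 * vbar * sqrt (A / 2) * sqrt (real T)" "0 \<le> ?B"
    using Lam_pos vbar0 A_nonneg by (auto intro!: mult_nonneg_nonneg sum_nonneg)
  ultimately show ?thesis using vbar0 by simp
next
  case False
  have "rho * real T - (\<Sum>t<T. of_bool (X v p t) * cst (v (Suc t)) (p (Suc t))) < vbar"
    using bud_inactive[OF False] by (simp add: bud_eq)
  moreover have "(\<Sum>t<T. of_bool (X v p t) * cst (v (Suc t)) (p (Suc t)))
      = ?M + (\<Sum>t<T. of_bool (X v p t) * cb (v (Suc t)))"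
    unfolding sum.distrib[symmetric] by (intro sum.cong refl) (simp add: algebra_simps)
  moreover have "(\<Sum>t<T. of_bool (X v p t) * cb (v (Suc t))) \<le> (\<Sum>t<T. drift v p t + rho * of_bool (act v p t)
    + 3 * vbar * (of_bool (X v p t) * ep v p t) + vbar * of_bool (bad rb cb v p t) + vbar * of_bool (t = 0))"
    using cb v by (intro sum_mono cost_le) auto
  moreover have "(\<Sum>t<T. drift v p t + rho * of_bool (act v p t)
      + 3 * vbar * (of_bool (X v p t) * ep v p t) + vbar * of_bool (bad rb cb v p t) + vbar * of_bool (t = 0))
    = (\<Sum>t<T. drift v p t) + rho * (\<Sum>t<T. of_bool (act v p t))
      + 3 * vbar * (\<Sum>t<T. of_bool (X v p t) * ep v p t) + ?B + vbar * (\<Sum>t<T. of_bool (t = 0))"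
    by (simp only: sum.distrib sum_distrib_left)
  moreover have "(\<Sum>t<T. of_bool (t = 0)) = (1::real)"
    using T_ge by (simp add: of_bool_def sum.delta)
  moreover have "(\<Sum>t<T. of_bool (act v p t)) = real T - (\<Sum>t<T. of_bool (\<not> act v p t))"
    by (simp add: of_bool_not_iff sum_subtractf)
  moreover have "(\<Sum>t<T. drift v p t) \<le> Lam * vbar * sqrt (real T)"
  proof -
    have "lam v p T * (vbar * sqrt (real T)) \<le> Lam * (vbar * sqrt (real T))"
      using lam_bounds vbar0 by (intro mult_right_mono) auto
    then show ?thesis using sum_drift[of T] by simp
  qed
  moreover have "3 * vbar * (\<Sum>t<T. of_bool (X v p t) * ep v p t) \<le> 3 * vbar * (3 * sqrt (A / 2) * sqrt (real T))"
    using vbar0 by (intro mult_left_mono sum_X_ep) auto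
  ultimately show ?thesis by (simp add: algebra_simps)
qed

lemma total_loss_le:
  assumes rb: "\<And>u. 0 \<le> u \<Longrightarrow> u \<le> vbar \<Longrightarrow> 0 \<le> rb u \<and> rb u \<le> u"
    and cb: "\<And>u. 0 \<le> u \<Longrightarrow> u \<le> vbar \<Longrightarrow> 0 \<le> cb u \<and> cb u \<le> u"
  shows "(\<Sum>t<T. of_bool (\<not> X v p t) * rb (v (Suc t))) \<le>
    (\<Sum>t<T. of_bool (act v p t) * lam v p t * (cb (v (Suc t)) - rho)) + slack
    + ((1 + Lam) * vbar + vbar / rho * vbar) * (\<Sum>t<T. of_bool (bad rb cb v p t))
    + vbar / rho * \<bar>\<Sum>t<T. of_bool (X v p t) * (cst (v (Suc t)) (p (Suc t)) - cb (v (Suc t)))\<bar>"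
proof -
  let ?B = "\<Sum>t<T. of_bool (bad rb cb v p t) :: real"
  let ?M = "\<Sum>t<T. of_bool (X v p t) * (cst (v (Suc t)) (p (Suc t)) - cb (v (Suc t)))"
  let ?I = "\<Sum>t<T. of_bool (\<not> act v p t) :: real"
  have "(\<Sum>t<T. of_bool (\<not> X v p t) * rb (v (Suc t))) \<le>
    (\<Sum>t<T. of_bool (act v p t) * lam v p t * (cb (v (Suc t)) - rho) + - (lam v p t * drift v p t)
    + (1 + Lam) * vbar * of_bool (bad rb cb v p t) + vbar * of_bool (\<not> act v p t))"
    using rb cb v by (intro sum_mono loss_le) auto
  also have "\<dots> = (\<Sum>t<T. of_bool (act v p t) * lam v p t * (cb (v (Suc t)) - rho))
      + (\<Sum>t<T. - (lam v p t * drift v p t)) + (1 + Lam) * vbar * ?B + vbar * ?I"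
    by (simp only: sum.distrib sum_distrib_left)
  finally have 1: "(\<Sum>t<T. of_bool (\<not> X v p t) * rb (v (Suc t))) \<le> \<dots>" .
  have "vbar / 2 * (Lam\<^sup>2 - (lam v p T)\<^sup>2) * sqrt (real T) \<le> vbar / 2 * Lam\<^sup>2 * sqrt (real T)"
    using vbar0 by (intro mult_right_mono mult_left_mono) auto
  then have 2: "(\<Sum>t<T. - (lam v p t * drift v p t))
      \<le> vbar / 2 * Lam\<^sup>2 * sqrt (real T) + (2 * vbar * sqrt (real T) + 4 * vbar * A * ln (real T))"
    using regret_dual[of T] sum_regret_terms by linarith
  have "vbar / rho * (rho * ?I) \<le> vbar / rho * (2 * vbar + \<bar>?M\<bar>
    + Lam * vbar * sqrt (real T) + 9 * vbar * sqrt (A / 2) * sqrt (real T) + vbar * ?B)"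
    using vbar0 rho0 cb by (intro mult_left_mono idle_le) auto
  moreover have "vbar / rho * (rho * ?I) = vbar * ?I" using rho0 by simp
  ultimately have 3: "vbar * ?I \<le> vbar / rho * (2 * vbar + \<bar>?M\<bar>
    + Lam * vbar * sqrt (real T) + 9 * vbar * sqrt (A / 2) * sqrt (real T) + vbar * ?B)" by linarith
  show ?thesis using 1 2 3 unfolding slack_def ring_distribs by argo
qed

end

end

section \<open>Conditional means over the bid, and Hoeffding's lemma\<close>

context auction
begin

lemma V_bounds: "0 \<le> V w t \<and> V w t \<le> vbar"
  using vbar_pos by (simp add: V_def clip_bounds)

lemma Q_bounds: "0 \<le> Q w t \<and> Q w t \<le> vbar"
  using vbar_pos by (simp add: Q_def clip_bounds)

lemma V_update: "V (w(t := y)) s = (if s = t then clip vbar (fst y) else V w s)"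
  by (simp add: V_def vv_def)

lemma Q_update: "Q (w(t := y)) s = (if s = t then clip vbar (fst (snd y)) else Q w s)"
  by (simp add: Q_def pp_def)

lemma integrable_P: "f \<in> borel_measurable P \<Longrightarrow> (\<And>x. \<bar>f x\<bar> \<le> (K::real)) \<Longrightarrow> integrable P f"
  by (rule integrable_bounded[OF P.finite_measure_axioms])

text \<open>Conditional mean of \<open>f\<close> given that the value of the round is
  \<open>u\<close>.\<close>

definition bar :: "(real \<Rightarrow> real \<Rightarrow> real) \<Rightarrow> real \<Rightarrow> real" where
  "bar f u = (\<integral>p. f u (clip vbar p) \<partial>G)"

lemma bar_measurable:
  assumes [measurable]: "(\<lambda>(u, q). f u q) \<in> borel_measurable (borel \<Otimes>\<^sub>M borel)"
  shows "bar f \<in> borel_measurable borel"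
  unfolding bar_def by measurable

lemma bar_integrable:
  assumes [measurable]: "(\<lambda>(u, q). f u q) \<in> borel_measurable (borel \<Otimes>\<^sub>M borel)"
    and bd: "\<And>q. 0 \<le> q \<Longrightarrow> q \<le> vbar \<Longrightarrow> \<bar>f u q\<bar> \<le> (K::real)"
  shows "integrable G (\<lambda>p. f u (clip vbar p))"
  using vbar_pos by (intro integrable_bounded[where K = K] G.finite_measure_axioms bd) (auto simp: clip_bounds)

lemma bar_bounds:
  assumes m: "(\<lambda>(u, q). f u q) \<in> borel_measurable (borel \<Otimes>\<^sub>M borel)"
    and bd: "\<And>q. 0 \<le> q \<Longrightarrow> q \<le> vbar \<Longrightarrow> 0 \<le> f u q \<and> f u q \<le> u"
  shows "0 \<le> bar f u \<and> bar f u \<le> u"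
proof -
  have i: "integrable G (\<lambda>p. f u (clip vbar p))"
    by (rule bar_integrable[OF m, of _ "\<bar>u\<bar>"]) (use bd in force)
  have b: "0 \<le> f u (clip vbar p) \<and> f u (clip vbar p) \<le> u" for p
    using vbar_pos by (intro bd) (auto simp: clip_bounds)
  have "bar f u \<le> (\<integral>p. u \<partial>G)" unfolding bar_def using i b by (intro integral_mono) auto
  moreover have "0 \<le> bar f u" unfolding bar_def using b by simp
  ultimately show ?thesis by (simp add: G.prob_space[simplified])
qed

text \<open>The indices \<open>j\<close> and \<open>t\<close> are separate because the concentration
  argument evaluates old bids at the value of a later round.\<close>

lemma expect_bid:
  assumes [measurable]: "H \<in> borel_measurable P" "(\<lambda>(u, q). f u q) \<in> borel_measurable (borel \<Otimes>\<^sub>M borel)"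
    and H: "\<And>w. \<bar>H w\<bar> \<le> (KH::real)"
    and f: "\<And>u q. 0 \<le> u \<Longrightarrow> u \<le> vbar \<Longrightarrow> 0 \<le> q \<Longrightarrow> q \<le> vbar \<Longrightarrow> \<bar>f u q\<bar> \<le> (Kf::real)"
    and inv: "\<And>w v p p' g g'. H (w(t := (v, p, g))) = H (w(t := (v, p', g')))"
  shows "(\<integral>w. H w * f (V w j) (Q w t) \<partial>P) = (\<integral>w. H w * bar f (V w j) \<partial>P)"
proof -
  have "(\<integral>w. H w * f (V w j) (clip vbar (pp w t)) \<partial>P) = (\<integral>w. (\<integral>p. H w * f (V w j) (clip vbar p) \<partial>G) \<partial>P)"
  proof (rule resample_bid[where K = "KH * Kf"])
    show "\<bar>H w * f (V w j) (clip vbar p)\<bar> \<le> KH * Kf" for w p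
      unfolding abs_mult using V_bounds[of w j] vbar_pos H[of w]
      by (intro mult_mono f) (auto simp: clip_bounds)
    show "H (w(t := (v, p, g))) * f (V (w(t := (v, p, g))) j) (clip vbar q)
        = H (w(t := (v, p', g'))) * f (V (w(t := (v, p', g'))) j) (clip vbar q)" for w v p p' g g' q
      using inv[of w v p g p' g'] by (simp add: V_update)
  qed measurable
  then show ?thesis by (simp add: Q_def bar_def)
qed

lemma expect_value:
  assumes [measurable]: "H \<in> borel_measurable P" "h \<in> borel_measurable borel"
    and H: "\<And>w. \<bar>H w\<bar> \<le> (KH::real)"
    and h: "\<And>u. 0 \<le> u \<Longrightarrow> u \<le> vbar \<Longrightarrow> \<bar>h u\<bar> \<le> (Kh::real)"
    and inv: "\<And>w y z. H (w(t := y)) = H (w(t := z))"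
  shows "(\<integral>w. H w * h (V w t) \<partial>P) = (\<integral>w. H w \<partial>P) * (\<integral>v. h (clip vbar v) \<partial>F)"
proof -
  have "(\<integral>w. H w * h (clip vbar (vv w t)) \<partial>P) = (\<integral>w. (\<integral>v. H w * h (clip vbar v) \<partial>F) \<partial>P)"
  proof (rule resample_value[where K = "KH * Kh"])
    show "\<bar>H w * h (clip vbar v)\<bar> \<le> KH * Kh" for w v
      unfolding abs_mult using vbar_pos H[of w]
      by (intro mult_mono h) (auto simp: clip_bounds)
    show "H (w(t := y)) * h (clip vbar q) = H (w(t := z)) * h (clip vbar q)" for w y z q
      using inv[of w y z] by simp
  qed measurable
  then show ?thesis by (simp add: V_def)
qed

lemma hoeffding_exp:
  assumes [measurable]: "h \<in> borel_measurable borel" and h: "\<And>q. 0 \<le> h q \<and> h q \<le> (1::real)"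
  shows "(\<integral>q. exp (l * (h q - (\<integral>q. h q \<partial>G))) \<partial>G) \<le> exp (l\<^sup>2 / 8)"
proof -
  \<comment> \<open>The left end \<open>a\<close> of the range is free so that a negative
    \<open>l\<close> reduces to a positive one by passing to \<open>- h\<close>, which lies in
    \<open>[-1, 0]\<close>.\<close>
  have pos: "(\<integral>q. exp (l * (h q - (\<integral>q. h q \<partial>G))) \<partial>G) \<le> exp (l\<^sup>2 / 8)"
    if "0 < l" and [measurable]: "h \<in> borel_measurable borel" and h: "\<And>q. a \<le> h q \<and> h q \<le> (a + 1::real)"
    for h :: "real \<Rightarrow> real" and l a
  proof -
    interpret interval_bounded_random_variable G h a "a + 1"
      by unfold_locales (use h in \<open>auto\<close>)
    have "(\<integral>\<^sup>+q. ennreal (exp (l * (h q - (\<integral>q. h q \<partial>G)))) \<partial>G) \<le> ennreal (exp (l\<^sup>2 / 8))"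
      using Hoeffdings_lemma_nn_integral[OF \<open>0 < l\<close>] by simp
    then have "enn2real (\<integral>\<^sup>+q. ennreal (exp (l * (h q - (\<integral>q. h q \<partial>G)))) \<partial>G) \<le> exp (l\<^sup>2 / 8)"
      by (intro enn2real_leI) auto
    then show ?thesis by (subst integral_eq_nn_integral) auto
  qed
  consider "l = 0" | "0 < l" | "0 < - l" by linarith
  then show ?thesis
  proof cases
    case 1
    then show ?thesis by (simp add: G.prob_space[simplified])
  next
    case 2
    then show ?thesis using pos[of l h 0] h by simp
  next
    case 3
    then show ?thesis using pos[of "- l" "\<lambda>q. - h q" "- 1"] h by (simp add: algebra_simps)
  qed
qed

end

lemma rwd_pair_measurable [measurable]: "(\<lambda>(x, y). rwd x y) \<in> borel_measurable (borel \<Otimes>\<^sub>M borel)"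
  by measurable

lemma cst_pair_measurable [measurable]: "(\<lambda>(x, y). cst x y) \<in> borel_measurable (borel \<Otimes>\<^sub>M borel)"
  by measurable

section \<open>Measurability of the OGD-CB state\<close>

context ogd
begin

context
  fixes M :: "'a measure" and v p :: "'a \<Rightarrow> nat \<Rightarrow> real"
  assumes v_measurable [measurable]: "\<And>t. (\<lambda>w. v w t) \<in> borel_measurable M"
    and p_measurable [measurable]: "\<And>t. (\<lambda>w. p w t) \<in> borel_measurable M"
begin

text \<open>The observed bids form a list-valued random variable. In place of a sigma-algebra on
  lists, measurability of all sums over the list is carried through the recursion: the constant 1
  gives its length, \<open>rwd\<close> and \<open>cst\<close> give the empirical means.\<close>

definition sums_measurable :: "nat \<Rightarrow> bool" where
  "sums_measurable t \<longleftrightarrow> (\<forall>f u. (\<lambda>(x, y). f x y) \<in> borel_measurable (borel \<Otimes>\<^sub>M borel) \<longrightarrow>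
     u \<in> borel_measurable M \<longrightarrow> (\<lambda>w. \<Sum>q\<leftarrow>bids (v w) (p w) t. f (u w :: real) q :: real) \<in> borel_measurable M)"

lemma sums_measurableD:
  assumes "sums_measurable t"
    and "(\<lambda>(x, y). f x y) \<in> borel_measurable (borel \<Otimes>\<^sub>M borel)" "u \<in> borel_measurable M"
  shows "(\<lambda>w. \<Sum>q\<leftarrow>bids (v w) (p w) t. f (u w :: real) q :: real) \<in> borel_measurable M"
  using assms unfolding sums_measurable_def by blast

lemma length_measurable_aux:
  assumes "sums_measurable t"
  shows "(\<lambda>w. real (length (bids (v w) (p w) t))) \<in> borel_measurable M"
proof -
  have "(\<lambda>w. \<Sum>q\<leftarrow>bids (v w) (p w) t. (\<lambda>_ _. 1) (0::real) q :: real) \<in> borel_measurable M"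
    by (rule sums_measurableD[OF assms]) measurable
  then show ?thesis by (simp add: sum_list_triv)
qed

lemma X_measurable_aux:
  assumes S: "sums_measurable t" and [measurable]: "(\<lambda>w. lam (v w) (p w) t) \<in> borel_measurable M"
    "Measurable.pred M (\<lambda>w. act (v w) (p w) t)"
  shows "Measurable.pred M (\<lambda>w. X (v w) (p w) t)" "(\<lambda>w. ctil (v w) (p w) t) \<in> borel_measurable M"
    "(\<lambda>w. ep (v w) (p w) t) \<in> borel_measurable M"
proof -
  note [measurable] = length_measurable_aux[OF S] sums_measurableD[OF S rwd_pair_measurable v_measurable]
    sums_measurableD[OF S cst_pair_measurable v_measurable]
  show [measurable]: "(\<lambda>w. ep (v w) (p w) t) \<in> borel_measurable M"
    unfolding ep_def ogd_eps_def by measurable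
  show [measurable]: "(\<lambda>w. ctil (v w) (p w) t) \<in> borel_measurable M"
    unfolding ctil_def ogd_c_def by measurable
  have [measurable]: "(\<lambda>w. rtil (v w) (p w) t) \<in> borel_measurable M"
    unfolding rtil_def ogd_r_def by measurable
  show "Measurable.pred M (\<lambda>w. X (v w) (p w) t)"
  proof (cases "t = 0")
    case True
    then show ?thesis by (simp add: X_first)
  next
    case False
    then have "1 \<le> t" by simp
    have [measurable]: "Measurable.pred M (\<lambda>w. lam (v w) (p w) t * ctil (v w) (p w) t \<le> rtil (v w) (p w) t)"
      unfolding pred_def by (intro borel_measurable_le) measurable
    show ?thesis unfolding X_eq[OF \<open>1 \<le> t\<close>] by measurable
  qed
qed

lemma state_measurable:
  "sums_measurable t \<and> (\<lambda>w. lam (v w) (p w) t) \<in> borel_measurable M \<and>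
   (\<lambda>w. bud (v w) (p w) t) \<in> borel_measurable M \<and> Measurable.pred M (\<lambda>w. act (v w) (p w) t)"
proof (induction t)
  case 0
  show ?case by (simp add: init sums_measurable_def)
next
  case (Suc t)
  then have S: "sums_measurable t" and [measurable]: "(\<lambda>w. lam (v w) (p w) t) \<in> borel_measurable M"
    "(\<lambda>w. bud (v w) (p w) t) \<in> borel_measurable M" "Measurable.pred M (\<lambda>w. act (v w) (p w) t)" by auto
  note [measurable] = X_measurable_aux[OF S \<open>(\<lambda>w. lam (v w) (p w) t) \<in> borel_measurable M\<close> \<open>Measurable.pred M (\<lambda>w. act (v w) (p w) t)\<close>]
  have b[measurable]: "(\<lambda>w. bud (v w) (p w) (Suc t)) \<in> borel_measurable M"
    unfolding bud_step by measurable
  have a: "Measurable.pred M (\<lambda>w. act (v w) (p w) (Suc t))"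
    unfolding act_step by measurable
  have l: "(\<lambda>w. lam (v w) (p w) (Suc t)) \<in> borel_measurable M"
  proof (cases "t = 0")
    case True
    then show ?thesis by (simp add: lam_first)
  next
    case False
    have "(\<lambda>w. lam (v w) (p w) (Suc t)) = (\<lambda>w. if act (v w) (p w) t then
        max 0 (lam (v w) (p w) t + 1 / (vbar * sqrt (real (Suc t))) * (of_bool (X (v w) (p w) t) * ctil (v w) (p w) t - rho))
        else lam (v w) (p w) t)"
      using False lam_step step_inactive(3) by (auto simp: fun_eq_iff)
    then show ?thesis by simp
  qed
  have "sums_measurable (Suc t)"
    unfolding sums_measurable_def
  proof (intro allI impI)
    fix f :: "real \<Rightarrow> real \<Rightarrow> real" and u :: "_ \<Rightarrow> real"
    assume f[measurable]: "(\<lambda>(x, y). f x y) \<in> borel_measurable (borel \<Otimes>\<^sub>M borel)"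
      and u[measurable]: "u \<in> borel_measurable M"
    note [measurable] = sums_measurableD[OF S f u]
    have "(\<lambda>w. \<Sum>q\<leftarrow>bids (v w) (p w) (Suc t). f (u w) q) = (\<lambda>w. (\<Sum>q\<leftarrow>bids (v w) (p w) t. f (u w) q)
        + (if act (v w) (p w) t \<and> (full \<or> X (v w) (p w) t) then f (u w) (p w (Suc t)) else 0))"
      by (auto simp: bids_step fun_eq_iff)
    then show "(\<lambda>w. \<Sum>q\<leftarrow>bids (v w) (p w) (Suc t). f (u w) q) \<in> borel_measurable M" by simp
  qed
  with a b l show ?case by blast
qed

lemma lam_measurable: "(\<lambda>w. lam (v w) (p w) t) \<in> borel_measurable M"
  and act_measurable: "Measurable.pred M (\<lambda>w. act (v w) (p w) t)"
  using state_measurable by auto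

lemma X_measurable: "Measurable.pred M (\<lambda>w. X (v w) (p w) t)"
  and ep_measurable: "(\<lambda>w. ep (v w) (p w) t) \<in> borel_measurable M"
  using X_measurable_aux state_measurable by auto

lemma length_measurable: "(\<lambda>w. real (length (bids (v w) (p w) t))) \<in> borel_measurable M"
  using length_measurable_aux state_measurable by auto

lemma sum_bids_measurable:
  assumes "(\<lambda>(x, y). f x y) \<in> borel_measurable (borel \<Otimes>\<^sub>M borel)" "u \<in> borel_measurable M"
  shows "(\<lambda>w. \<Sum>q\<leftarrow>bids (v w) (p w) t. f (u w :: real) q :: real) \<in> borel_measurable M"
  using sums_measurableD assms state_measurable by auto

lemma rev_measurable: "(\<lambda>w. ogd_rev full vbar rho (v w) (p w) T) \<in> borel_measurable M"
proof -
  note [measurable] = X_measurable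
  show ?thesis unfolding rev_eq by measurable
qed

end

end

locale auction_ogd = auction vbar F G + ogd full vbar rho T
  for vbar F G full rho T
begin

abbreviation "obids w t \<equiv> bids (V w) (Q w) t"
abbreviation "oX w t \<equiv> X (V w) (Q w) t"
abbreviation "olam w t \<equiv> lam (V w) (Q w) t"
abbreviation "oact w t \<equiv> act (V w) (Q w) t"

lemmas clipped_measurable [measurable] =
  lam_measurable[where v = V and p = Q, OF V_measurable Q_measurable] act_measurable[where v = V and p = Q, OF V_measurable Q_measurable]
  X_measurable[where v = V and p = Q, OF V_measurable Q_measurable] ep_measurable[where v = V and p = Q, OF V_measurable Q_measurable]
  length_measurable[where v = V and p = Q, OF V_measurable Q_measurable]

lemma update_state:
  assumes "s < t"
  shows "obids (w(t := y)) s = obids w s" "olam (w(t := y)) s = olam w s"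
    "oact (w(t := y)) s = oact w s" "ep (V (w(t := y))) (Q (w(t := y))) s = ep (V w) (Q w) s"
  using assms by (intro state_cong; simp add: V_update Q_update)+

lemma update_X:
  assumes "Suc s < t"
  shows "oX (w(t := y)) s = oX w s"
  using assms by (intro X_cong; simp add: V_update Q_update)

lemma update_bid_X:
  "oX (w(Suc s := (v, p, g))) s = oX (w(Suc s := (v, p', g'))) s"
  by (intro X_cong; simp add: V_update Q_update)

end

lemma abs_sum_list_le:
  assumes "\<And>q. q \<in> set qs \<Longrightarrow> \<bar>f q\<bar> \<le> (K::real)"
  shows "\<bar>\<Sum>q\<leftarrow>qs. f q\<bar> \<le> real (length qs) * K"
  using assms
proof (induction qs)
  case (Cons a qs)
  then have "\<bar>f a\<bar> \<le> K" "\<bar>\<Sum>q\<leftarrow>qs. f q\<bar> \<le> real (length qs) * K" by auto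
  then show ?case using abs_triangle_ineq[of "f a" "\<Sum>q\<leftarrow>qs. f q"] by (simp add: algebra_simps)
qed simp

context auction_ogd
begin

subsection \<open>Concentration under adaptive sampling\<close>

text \<open>With partial feedback the set of observed bids is chosen adaptively, but a bid is independent
  of the decision to observe it, so the exponential process below stays a supermartingale.\<close>

lemma exp_supermartingale:
  fixes l :: real
  assumes h[measurable]: "(\<lambda>(u, q). h u q) \<in> borel_measurable (borel \<Otimes>\<^sub>M borel)"
    and hb: "\<And>u q. 0 \<le> u \<Longrightarrow> u \<le> vbar \<Longrightarrow> 0 \<le> q \<Longrightarrow> q \<le> vbar \<Longrightarrow> 0 \<le> h u q \<and> h u q \<le> (1::real)"
  defines "W \<equiv> \<lambda>j s w. exp (l * (\<Sum>q\<leftarrow>obids w s. h (V w j) q - bar h (V w j)) - l\<^sup>2 / 8 * real (length (obids w s)))"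
  shows "(\<lambda>w. W j s w) \<in> borel_measurable P" (is ?m)
    and "\<bar>W j s w\<bar> \<le> exp (\<bar>l\<bar> * real s)"
    and "(\<integral>w. W j s w \<partial>P) \<le> 1" (is ?i)
proof -
  note [measurable] = bar_measurable[OF h]
  have k[measurable]: "(\<lambda>(u, q). h u q - bar h u) \<in> borel_measurable (borel \<Otimes>\<^sub>M borel)" by measurable
  note sum_bids_measurable[where v = V and p = Q, OF V_measurable Q_measurable k V_measurable, measurable]
  show mW[measurable]: "(\<lambda>w. W j s w) \<in> borel_measurable P" for j s
    unfolding W_def by measurable
  have bh: "0 \<le> bar h u \<and> bar h u \<le> 1" if "0 \<le> u" "u \<le> vbar" for u
  proof -
    have i: "integrable G (\<lambda>p. h u (clip vbar p))"
      by (rule bar_integrable[OF h, of _ 1]) (use hb that in force)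
    have b: "0 \<le> h u (clip vbar p) \<and> h u (clip vbar p) \<le> 1" for p
      using that vbar_pos by (intro hb) (auto simp: clip_bounds)
    have "bar h u \<le> (\<integral>p. 1 \<partial>G)" unfolding bar_def using i b by (intro integral_mono) auto
    moreover have "0 \<le> bar h u" unfolding bar_def using b by simp
    ultimately show ?thesis by (simp add: G.prob_space[simplified])
  qed
  have kb: "\<bar>h u q - bar h u\<bar> \<le> 1" if "0 \<le> u" "u \<le> vbar" "0 \<le> q" "q \<le> vbar" for u q
    using hb[OF that] bh[OF that(1,2)] by (simp add: abs_le_iff)
  have bW: "\<bar>W j s w\<bar> \<le> exp (\<bar>l\<bar> * real s)" for j s w
  proof -
    have "\<bar>\<Sum>q\<leftarrow>obids w s. h (V w j) q - bar h (V w j)\<bar> \<le> real (length (obids w s)) * 1"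
    proof (rule abs_sum_list_le)
      fix q assume "q \<in> set (obids w s)"
      then have "0 \<le> q \<and> q \<le> vbar"
        using bids_bounds[of "V w" "Q w"] V_bounds Q_bounds by blast
      then show "\<bar>h (V w j) q - bar h (V w j)\<bar> \<le> 1" using V_bounds[of w j] by (intro kb) auto
    qed
    also have "\<dots> \<le> real s" using length_bids_le by simp
    finally have "\<bar>l\<bar> * \<bar>\<Sum>q\<leftarrow>obids w s. h (V w j) q - bar h (V w j)\<bar> \<le> \<bar>l\<bar> * real s"
      by (intro mult_left_mono) auto
    then have "l * (\<Sum>q\<leftarrow>obids w s. h (V w j) q - bar h (V w j)) \<le> \<bar>l\<bar> * real s"
      using abs_ge_self[of "l * (\<Sum>q\<leftarrow>obids w s. h (V w j) q - bar h (V w j))"] unfolding abs_mult by linarith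
    moreover have "0 \<le> l\<^sup>2 / 8 * real (length (obids w s))" by simp
    ultimately show ?thesis unfolding W_def abs_exp_cancel exp_le_cancel_iff by linarith
  qed
  show "\<bar>W j s w\<bar> \<le> exp (\<bar>l\<bar> * real s)" by (rule bW)
  show ?i
  proof (induction s)
    case 0
    show ?case by (simp add: W_def init P.prob_space[simplified])
  next
    case (Suc s)
    \<comment> \<open>Whether the bid of round \<open>Suc s\<close> enters the list; this is settled
      before the bid is seen, so the bid may be redrawn.\<close>
    define ob where "ob w \<longleftrightarrow> oact w s \<and> (full \<or> oX w s)" for w
    have [measurable]: "Measurable.pred P ob" unfolding ob_def by measurable
    define \<kappa> where "\<kappa> u q = exp (l * (h u q - bar h u) - l\<^sup>2 / 8)" for u q
    have m\<kappa>[measurable]: "(\<lambda>(u, q). \<kappa> u q) \<in> borel_measurable (borel \<Otimes>\<^sub>M borel)"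
      unfolding \<kappa>_def by measurable
    have b\<kappa>: "\<bar>\<kappa> u q\<bar> \<le> exp \<bar>l\<bar>" if "0 \<le> u" "u \<le> vbar" "0 \<le> q" "q \<le> vbar" for u q
    proof -
      have "l * (h u q - bar h u) \<le> \<bar>l\<bar> * 1"
        using mult_mono[OF order_refl kb[OF that], of "\<bar>l\<bar>"] by (simp flip: abs_mult)
      moreover have "0 \<le> l\<^sup>2 / 8" by simp
      ultimately show ?thesis unfolding \<kappa>_def abs_exp_cancel exp_le_cancel_iff by linarith
    qed
    \<comment> \<open>Hoeffding's lemma for a single bid: the compensator \<open>l^2 / 8\<close>
      ensures that one more observation does not raise the expectation.\<close>
    have bar\<kappa>: "bar \<kappa> u \<le> 1" if "0 \<le> u" "u \<le> vbar" for u
    proof -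
      have "(\<integral>q. exp (l * (h u (clip vbar q) - (\<integral>q. h u (clip vbar q) \<partial>G))) \<partial>G) \<le> exp (l\<^sup>2 / 8)"
      proof (rule hoeffding_exp)
        show "(\<lambda>q. h u (clip vbar q)) \<in> borel_measurable borel" by measurable
        show "0 \<le> h u (clip vbar q) \<and> h u (clip vbar q) \<le> 1" for q
          using that vbar_pos by (intro hb) (auto simp: clip_bounds)
      qed
      then show ?thesis unfolding bar_def \<kappa>_def by (simp add: exp_diff)
    qed
    have upd: "W j (Suc s) w = W j s w * of_bool (\<not> ob w) + (W j s w * of_bool (ob w)) * \<kappa> (V w j) (Q w (Suc s))" for w
    proof (cases "ob w")
      case True
      then have b: "obids w (Suc s) = obids w s @ [Q w (Suc s)]"
        unfolding ob_def bids_step by (rule if_P)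
      have "W j (Suc s) w = W j s w * \<kappa> (V w j) (Q w (Suc s))"
        unfolding W_def \<kappa>_def b exp_add[symmetric] by (simp add: algebra_simps add_divide_distrib)
      then show ?thesis using True by simp
    next
      case False
      then have b: "obids w (Suc s) = obids w s"
        unfolding ob_def bids_step by (rule if_not_P)
      show ?thesis using False by (simp add: W_def b)
    qed
    have H: "\<bar>W j s w * of_bool (ob w)\<bar> \<le> exp (\<bar>l\<bar> * real s)" for w
      using bW[of j s w] by (cases "ob w") auto
    have H': "\<bar>W j s w * of_bool (\<not> ob w)\<bar> \<le> exp (\<bar>l\<bar> * real s)" for w
      using bW[of j s w] by (cases "ob w") auto
    have int1: "integrable P (\<lambda>w. W j s w * of_bool (ob w))"
      by (rule integrable_P[OF _ H]) measurable
    have int2: "integrable P (\<lambda>w. W j s w * of_bool (\<not> ob w))"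
      by (rule integrable_P[OF _ H']) measurable
    have \<kappa>V: "\<bar>\<kappa> (V w j) (Q w t)\<bar> \<le> exp \<bar>l\<bar>" for w t using V_bounds Q_bounds by (intro b\<kappa>) auto
    have int3: "integrable P (\<lambda>w. (W j s w * of_bool (ob w)) * \<kappa> (V w j) (Q w (Suc s)))"
    proof (rule integrable_P[where K = "exp (\<bar>l\<bar> * real s) * exp \<bar>l\<bar>"])
      show "\<bar>W j s w * of_bool (ob w) * \<kappa> (V w j) (Q w (Suc s))\<bar> \<le> exp (\<bar>l\<bar> * real s) * exp \<bar>l\<bar>" for w
        unfolding abs_mult[of "_ * _"] using H \<kappa>V by (intro mult_mono) auto
    qed measurable
    have nn: "0 \<le> \<kappa> u q" for u q by (simp add: \<kappa>_def)
    have bar_nn: "0 \<le> bar \<kappa> u" for u unfolding bar_def by (simp add: nn)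
    have int4: "integrable P (\<lambda>w. (W j s w * of_bool (ob w)) * bar \<kappa> (V w j))"
    proof (rule integrable_P[where K = "exp (\<bar>l\<bar> * real s) * 1"])
      show "(\<lambda>w. W j s w * of_bool (ob w) * bar \<kappa> (V w j)) \<in> borel_measurable P"
        using bar_measurable[OF m\<kappa>] by measurable
      show "\<bar>W j s w * of_bool (ob w) * bar \<kappa> (V w j)\<bar> \<le> exp (\<bar>l\<bar> * real s) * 1" for w
        unfolding abs_mult[of "_ * _"] using H bar\<kappa> bar_nn V_bounds[of w j] by (intro mult_mono) auto
    qed
    have "(\<integral>w. W j (Suc s) w \<partial>P) = (\<integral>w. W j s w * of_bool (\<not> ob w) \<partial>P)
        + (\<integral>w. (W j s w * of_bool (ob w)) * \<kappa> (V w j) (Q w (Suc s)) \<partial>P)"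
      unfolding upd using int2 int3 by (rule Bochner_Integration.integral_add)
    also have "(\<integral>w. (W j s w * of_bool (ob w)) * \<kappa> (V w j) (Q w (Suc s)) \<partial>P)
        = (\<integral>w. (W j s w * of_bool (ob w)) * bar \<kappa> (V w j) \<partial>P)"
    proof (rule expect_bid[OF _ m\<kappa> H b\<kappa>])
      show "W j s (w(Suc s := (v, p, g))) * of_bool (ob (w(Suc s := (v, p, g))))
          = W j s (w(Suc s := (v, p', g'))) * of_bool (ob (w(Suc s := (v, p', g'))))" for w v p p' g g'
        unfolding W_def ob_def using update_bid_X[of w s v p g p' g'] by (simp add: update_state V_update)
    qed measurable
    also have "\<dots> \<le> (\<integral>w. W j s w * of_bool (ob w) \<partial>P)"
    proof (rule integral_mono[OF int4 int1])
      fix w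
      have "0 \<le> W j s w * of_bool (ob w)" by (simp add: W_def)
      then show "W j s w * of_bool (ob w) * bar \<kappa> (V w j) \<le> W j s w * of_bool (ob w)"
        using mult_left_mono[OF bar\<kappa>[of "V w j"], of "W j s w * of_bool (ob w)"] V_bounds[of w j] by simp
    qed
    also have "(\<integral>w. W j s w * of_bool (\<not> ob w) \<partial>P) + (\<integral>w. W j s w * of_bool (ob w) \<partial>P)
        = (\<integral>w. W j s w * of_bool (\<not> ob w) + W j s w * of_bool (ob w) \<partial>P)"
      using int2 int1 by (rule Bochner_Integration.integral_add[symmetric])
    also have "(\<lambda>w. W j s w * of_bool (\<not> ob w) + W j s w * of_bool (ob w)) = (\<lambda>w. W j s w)"
      by (auto simp: fun_eq_iff)
    finally show ?case using Suc by simp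
  qed
qed

text \<open>One half of \<open>bad\<close>, for a single function \<open>f\<close> on the clipped
  sample.\<close>

definition deviates :: "(real \<Rightarrow> real \<Rightarrow> real) \<Rightarrow> (nat \<Rightarrow> real \<times> real \<times> real) \<Rightarrow> nat \<Rightarrow> bool" where
  "deviates f w t \<longleftrightarrow> 1 \<le> t \<and>
     \<not> \<bar>(\<Sum>q\<leftarrow>obids w t. f (V w (Suc t)) q) / real (length (obids w t)) - bar f (V w (Suc t))\<bar>
       \<le> ep (V w) (Q w) t * V w (Suc t)"

lemma deviates_measurable:
  assumes f[measurable]: "(\<lambda>(u, q). f u q) \<in> borel_measurable (borel \<Otimes>\<^sub>M borel)"
  shows "Measurable.pred P (\<lambda>w. deviates f w t)"
proof -
  note [measurable] = bar_measurable[OF f] sum_bids_measurable[where v = V and p = Q, OF V_measurable Q_measurable f V_measurable]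
  have [measurable]: "Measurable.pred P (\<lambda>w. \<bar>(\<Sum>q\<leftarrow>obids w t. f (V w (Suc t)) q) / real (length (obids w t)) - bar f (V w (Suc t))\<bar>
       \<le> ep (V w) (Q w) t * V w (Suc t))"
    unfolding pred_def by (intro borel_measurable_le) measurable
  show ?thesis unfolding deviates_def by measurable
qed

lemma sum_list_centered:
  "(\<Sum>q\<leftarrow>qs. f q / u - m / u) = ((\<Sum>q\<leftarrow>qs. f q) - real (length qs) * m) / (u::real)"
  by (induction qs) (simp_all add: algebra_simps add_divide_distrib diff_divide_distrib)

lemma exp_minus_A: "exp (- A) = 1 / (2 * (real T)\<^sup>2)"
proof -
  have "exp A = 2 * (real T)\<^sup>2"
    using T_ge unfolding A_def exp_add exp_double by simp
  then show ?thesis by (simp add: exp_minus inverse_eq_divide)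
qed

text \<open>A union bound over the random number \<open>n\<close> of observed bids and the sign of the deviation, with
  Chernoff parameter \<open>4 * ogd_eps T n\<close>; the sums are divided by \<open>u\<close> to have summands in \<open>[-1, 1]\<close>.\<close>

lemma prob_deviates:
  assumes f: "(\<lambda>(u, q). f u q) \<in> borel_measurable (borel \<Otimes>\<^sub>M borel)"
    and fb: "\<And>u q. 0 \<le> u \<Longrightarrow> u \<le> vbar \<Longrightarrow> 0 \<le> q \<Longrightarrow> q \<le> vbar \<Longrightarrow> 0 \<le> f u q \<and> f u q \<le> u"
    and t: "t < T"
  shows "(\<integral>w. of_bool (deviates f w t) \<partial>P) \<le> 1 / real T"
proof -
  define h where "h u q = f u q / u" for u q :: real
  have h[measurable]: "(\<lambda>(u, q). h u q) \<in> borel_measurable (borel \<Otimes>\<^sub>M borel)"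
    unfolding h_def using f by measurable
  have hb: "0 \<le> h u q \<and> h u q \<le> 1" if "0 \<le> u" "u \<le> vbar" "0 \<le> q" "q \<le> vbar" for u q
    using fb[OF that] that by (cases "u = 0") (auto simp: h_def)
  define W where "W l w = exp (l * (\<Sum>q\<leftarrow>obids w t. h (V w (Suc t)) q - bar h (V w (Suc t)))
      - l\<^sup>2 / 8 * real (length (obids w t)))" for l w
  note W = exp_supermartingale[OF h hb, where j = "Suc t" and s = t, folded W_def]
  note [measurable] = W(1) deviates_measurable[OF f]
  have intW: "integrable P (W l)" for l by (rule integrable_P[OF W(1) W(2)])
  have Wnn: "0 \<le> W l w" for l w by (simp add: W_def)
  have point: "of_bool (deviates f w t) \<le> (\<Sum>n=1..T. (W (4 * ogd_eps T n) w + W (- (4 * ogd_eps T n)) w) * exp (- A))" for w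
  proof (cases "deviates f w t")
    case False
    then show ?thesis by (auto simp: Wnn intro!: sum_nonneg mult_nonneg_nonneg add_nonneg_nonneg)
  next
    case True
    define n where "n = length (obids w t)"
    define e where "e = ogd_eps T n"
    define u where "u = V w (Suc t)"
    define S where "S = (\<Sum>q\<leftarrow>obids w t. h u q - bar h u)"
    have t1: "1 \<le> t" using True by (simp add: deviates_def)
    have n: "1 \<le> n" "n \<le> T" using length_bids_pos[OF t1] length_bids_le[of "V w" "Q w" t] t by (auto simp: n_def)
    have ub: "0 \<le> u" "u \<le> vbar" using V_bounds by (auto simp: u_def)
    have dev: "e * u < \<bar>(\<Sum>q\<leftarrow>obids w t. f u q) / real n - bar f u\<bar>"
      using True by (simp add: deviates_def u_def n_def e_def ep_def)
    have bb: "q \<in> set (obids w t) \<Longrightarrow> 0 \<le> q \<and> q \<le> vbar" for q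
      using bids_bounds[of "V w" "Q w"] V_bounds Q_bounds by auto
    \<comment> \<open>At value 0 both the mean and its estimate vanish, so a deviation implies a
      positive value and dividing by \<open>u\<close> is meaningful.\<close>
    have u: "0 < u"
    proof (rule ccontr)
      assume "\<not> 0 < u"
      then have u0: "u = 0" using ub by simp
      have "bar f u = 0" using bar_bounds[OF f, of u] fb ub u0 by fastforce
      moreover have "(\<Sum>q\<leftarrow>obids w t. f u q) = 0"
        using sum_list_bounds[of "obids w t" "f u" 0] fb[of u] bb ub u0 by fastforce
      ultimately show False using dev u0 by simp
    qed
    have barh: "bar h u = bar f u / u" by (simp add: bar_def h_def)
    have "S = ((\<Sum>q\<leftarrow>obids w t. f u q) - real n * bar f u) / u"
      unfolding S_def n_def barh h_def
      by (rule sum_list_centered)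
    also have "\<dots> = ((\<Sum>q\<leftarrow>obids w t. f u q) / real n - bar f u) * (real n / u)"
      using n u by (simp add: field_simps)
    finally have "\<bar>S\<bar> = \<bar>(\<Sum>q\<leftarrow>obids w t. f u q) / real n - bar f u\<bar> * (real n / u)"
      using u by (simp add: abs_mult)
    moreover have "(e * u) * (real n / u) \<le> \<bar>(\<Sum>q\<leftarrow>obids w t. f u q) / real n - bar f u\<bar> * (real n / u)"
      using dev u by (intro mult_right_mono) auto
    ultimately have Sn: "e * real n \<le> \<bar>S\<bar>" using u by simp
    have e2: "2 * real n * e\<^sup>2 = A" and e0: "0 \<le> e"
      using n A_nonneg by (auto simp: e_def ogd_eps_def A_def[symmetric])
    \<comment> \<open>With \<open>l = 4 * e\<close> of the right sign, the exponent is at least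
      \<open>4 * e^2 * n - 2 * e^2 * n = 2 * e^2 * n = A\<close>.\<close>
    define \<sigma> :: real where "\<sigma> = (if 0 \<le> S then 1 else - 1)"
    have "4 * e * (e * real n) \<le> 4 * e * \<bar>S\<bar>" using Sn e0 by (intro mult_left_mono) auto
    then have "2 * A \<le> (\<sigma> * (4 * e)) * S"
      using e2 by (auto simp: \<sigma>_def power2_eq_square mult_ac)
    moreover have "(\<sigma> * (4 * e))\<^sup>2 / 8 * real n = A"
      using e2 by (auto simp: \<sigma>_def power2_eq_square mult_ac)
    ultimately have "exp A \<le> W (\<sigma> * (4 * e)) w"
      unfolding W_def S_def[symmetric] n_def[symmetric] u_def[symmetric] by simp
    then have "exp A * exp (- A) \<le> W (\<sigma> * (4 * e)) w * exp (- A)" by (intro mult_right_mono) auto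
    then have "1 \<le> W (\<sigma> * (4 * e)) w * exp (- A)" by (simp flip: exp_add)
    also have "\<dots> \<le> (W (4 * e) w + W (- (4 * e)) w) * exp (- A)"
      using Wnn by (intro mult_right_mono) (auto simp: \<sigma>_def)
    also have "\<dots> \<le> (\<Sum>n=1..T. (W (4 * ogd_eps T n) w + W (- (4 * ogd_eps T n)) w) * exp (- A))"
      unfolding e_def using n Wnn by (intro member_le_sum) auto
    finally show ?thesis using True by simp
  qed
  have "(\<integral>w. of_bool (deviates f w t) \<partial>P) \<le> (\<integral>w. (\<Sum>n=1..T. (W (4 * ogd_eps T n) w + W (- (4 * ogd_eps T n)) w) * exp (- A)) \<partial>P)"
  proof (rule integral_mono[OF _ _ point])
    show "integrable P (\<lambda>w. of_bool (deviates f w t) :: real)" by (rule integrable_P[where K = 1]) auto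
    show "integrable P (\<lambda>w. \<Sum>n=1..T. (W (4 * ogd_eps T n) w + W (- (4 * ogd_eps T n)) w) * exp (- A))"
      by (intro Bochner_Integration.integrable_sum integrable_mult_left Bochner_Integration.integrable_add intW)
  qed
  also have "\<dots> = (\<Sum>n=1..T. ((\<integral>w. W (4 * ogd_eps T n) w \<partial>P) + (\<integral>w. W (- (4 * ogd_eps T n)) w \<partial>P)) * exp (- A))"
    using intW by (simp add: Bochner_Integration.integral_sum)
  \<comment> \<open>There are \<open>2 * T\<close> exponentials of mean at most 1, each weighted by
    \<open>1 / (2 * T^2)\<close>.\<close>
  also have "\<dots> \<le> (\<Sum>n=1..T. (1 + 1) * exp (- A))"
    by (intro sum_mono mult_right_mono add_mono W(3)) auto
  also have "\<dots> = 1 / real T" using T_ge by (simp add: exp_minus_A power2_eq_square)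
  finally show ?thesis .
qed

end

section \<open>Expected reward and payment under unconditional participation\<close>

context auction
begin

definition Rew :: real where "Rew = (\<integral>v. bar rwd (clip vbar v) \<partial>F)"

definition Cost :: real where "Cost = (\<integral>v. bar cst (clip vbar v) \<partial>F)"

lemma bar_rwd_bounds: "0 \<le> u \<Longrightarrow> 0 \<le> bar rwd u \<and> bar rwd u \<le> u"
  by (rule bar_bounds[OF rwd_pair_measurable]) (simp add: rwd_bounds)

lemma bar_cst_bounds: "0 \<le> u \<Longrightarrow> 0 \<le> bar cst u \<and> bar cst u \<le> u"
  by (rule bar_bounds[OF cst_pair_measurable]) (simp add: cst_bounds)

lemmas bar_rwd_measurable [measurable] = bar_measurable[OF rwd_pair_measurable]
lemmas bar_cst_measurable [measurable] = bar_measurable[OF cst_pair_measurable]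

lemma rwd_abs: "0 \<le> u \<Longrightarrow> u \<le> vbar \<Longrightarrow> 0 \<le> q \<Longrightarrow> q \<le> vbar \<Longrightarrow> \<bar>rwd u q\<bar> \<le> vbar"
  using rwd_bounds[of u q] by auto

lemma cst_abs: "0 \<le> u \<Longrightarrow> u \<le> vbar \<Longrightarrow> 0 \<le> q \<Longrightarrow> q \<le> vbar \<Longrightarrow> \<bar>cst u q\<bar> \<le> vbar"
  using cst_bounds[of u q] by auto

lemma rwd_VQ: "0 \<le> rwd (V w s) (Q w t) \<and> rwd (V w s) (Q w t) \<le> vbar"
  using rwd_bounds[of "V w s" "Q w t"] V_bounds[of w s] Q_bounds[of w t] by auto

lemma cst_VQ: "0 \<le> cst (V w s) (Q w t) \<and> cst (V w s) (Q w t) \<le> vbar"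
  using cst_bounds[of "V w s" "Q w t"] V_bounds[of w s] Q_bounds[of w t] by auto

lemma bar_rwd_V: "0 \<le> bar rwd (V w s) \<and> bar rwd (V w s) \<le> vbar"
  using bar_rwd_bounds[of "V w s"] V_bounds[of w s] by auto

lemma bar_cst_V: "0 \<le> bar cst (V w s) \<and> bar cst (V w s) \<le> vbar"
  using bar_cst_bounds[of "V w s"] V_bounds[of w s] by auto

lemma expect_bar_rwd: "(\<integral>w. bar rwd (V w t) \<partial>P) = Rew"
proof -
  have "(\<integral>w. 1 * bar rwd (V w t) \<partial>P) = (\<integral>w. 1 \<partial>P) * (\<integral>v. bar rwd (clip vbar v) \<partial>F)"
    by (rule expect_value[where KH = 1 and Kh = vbar]) (use bar_rwd_bounds in force)+
  then show ?thesis by (simp add: Rew_def P.prob_space[simplified])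
qed

lemma expect_rwd: "(\<integral>w. rwd (V w t) (Q w t) \<partial>P) = Rew"
proof -
  have "(\<integral>w. 1 * rwd (V w t) (Q w t) \<partial>P) = (\<integral>w. 1 * bar rwd (V w t) \<partial>P)"
    by (rule expect_bid[OF _ rwd_pair_measurable _ rwd_abs, where KH = 1]) auto
  then show ?thesis by (simp add: expect_bar_rwd)
qed

text \<open>Independence factors the expectation into the mean of \<open>H\<close> times
  \<open>Cost - rho\<close>. This is where the hypothesis on the expected payment enters, for both
  algorithms.\<close>

lemma expect_multiplier:
  assumes [measurable]: "H \<in> borel_measurable P" and H: "\<And>w. \<bar>H w\<bar> \<le> K" "\<And>w. 0 \<le> H w"
    and inv: "\<And>w y z. H (w(t := y)) = H (w(t := z))" and Cost: "Cost \<le> rho"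
  shows "(\<integral>w. H w * (bar cst (V w t) - rho) \<partial>P) \<le> 0"
proof -
  have "(\<integral>w. H w * bar cst (V w t) \<partial>P) = (\<integral>w. H w \<partial>P) * Cost"
    unfolding Cost_def
  proof (rule expect_value[where H = H and h = "bar cst" and KH = K and Kh = vbar])
    show "\<bar>bar cst u\<bar> \<le> vbar" if "0 \<le> u" "u \<le> vbar" for u
      using bar_cst_bounds[of u] that by auto
  qed (use H inv in auto)
  moreover have "integrable P (\<lambda>w. H w * bar cst (V w t))"
  proof (rule integrable_P[where K = "K * vbar"])
    show "\<bar>H w * bar cst (V w t)\<bar> \<le> K * vbar" for w
      unfolding abs_mult using H[of w] bar_cst_V[of w t] by (intro mult_mono) auto
  qed measurable
  moreover have "integrable P (\<lambda>w. H w * rho)" by (intro integrable_mult_left integrable_P[OF _ H(1)]) measurable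
  ultimately have "(\<integral>w. H w * (bar cst (V w t) - rho) \<partial>P) = (\<integral>w. H w \<partial>P) * (Cost - rho)"
    by (simp add: right_diff_distrib)
  moreover have "0 \<le> (\<integral>w. H w \<partial>P)" using H by simp
  ultimately show ?thesis using Cost by (simp add: mult_nonneg_nonpos)
qed

end

section \<open>Expected loss of OGD-CB\<close>

context auction_ogd
begin

lemma bad_eq: "bad (bar rwd) (bar cst) (V w) (Q w) t \<longleftrightarrow> deviates rwd w t \<or> deviates cst w t"
  unfolding bad_def deviates_def by blast

text \<open>Two functions and \<open>T\<close> rounds, each pair failing with probability at most
  \<open>1 / T\<close>.\<close>

lemma expect_bad:
  shows "(\<integral>w. (\<Sum>t<T. of_bool (bad (bar rwd) (bar cst) (V w) (Q w) t)) \<partial>P) \<le> (2::real)"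
    and "integrable P (\<lambda>w. \<Sum>t<T. of_bool (bad (bar rwd) (bar cst) (V w) (Q w) t) :: real)"
proof -
  note [measurable] = deviates_measurable[OF rwd_pair_measurable] deviates_measurable[OF cst_pair_measurable]
  have i: "integrable P (\<lambda>w. of_bool (deviates rwd w t) :: real)" "integrable P (\<lambda>w. of_bool (deviates cst w t) :: real)"
    "integrable P (\<lambda>w. of_bool (bad (bar rwd) (bar cst) (V w) (Q w) t) :: real)" for t
    unfolding bad_eq by (rule integrable_P[where K = 1]; auto; fail)+
  then show "integrable P (\<lambda>w. \<Sum>t<T. of_bool (bad (bar rwd) (bar cst) (V w) (Q w) t) :: real)"
    by (intro Bochner_Integration.integrable_sum)
  have each: "(\<integral>w. of_bool (bad (bar rwd) (bar cst) (V w) (Q w) t) \<partial>P) \<le> 2 / real T" if "t < T" for t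
  proof -
    have "(\<integral>w. of_bool (bad (bar rwd) (bar cst) (V w) (Q w) t) \<partial>P)
        \<le> (\<integral>w. (of_bool (deviates rwd w t) + of_bool (deviates cst w t) :: real) \<partial>P)"
      using i by (intro integral_mono) (auto simp: bad_eq)
    also have "\<dots> = (\<integral>w. of_bool (deviates rwd w t) \<partial>P) + (\<integral>w. of_bool (deviates cst w t) \<partial>P)"
      using i by simp
    also have "\<dots> \<le> 1 / real T + 1 / real T"
      using that by (intro add_mono prob_deviates rwd_pair_measurable cst_pair_measurable)
        (auto simp: rwd_bounds cst_bounds)
    finally show ?thesis by simp
  qed
  have "(\<integral>w. (\<Sum>t<T. of_bool (bad (bar rwd) (bar cst) (V w) (Q w) t)) \<partial>P)
      = (\<Sum>t<T. \<integral>w. (of_bool (bad (bar rwd) (bar cst) (V w) (Q w) t) :: real) \<partial>P)"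
    using i by (intro Bochner_Integration.integral_sum) auto
  also have "\<dots> \<le> (\<Sum>t<T. 2 / real T)" by (intro sum_mono each) auto
  finally show "(\<integral>w. (\<Sum>t<T. of_bool (bad (bar rwd) (bar cst) (V w) (Q w) t)) \<partial>P) \<le> (2::real)"
    using T_ge by simp
qed

text \<open>The martingale part of the spending: payments minus their means given value and
  decision.\<close>

definition noise :: "nat \<Rightarrow> (nat \<Rightarrow> real \<times> real \<times> real) \<Rightarrow> real" where
  "noise m w = (\<Sum>t<m. of_bool (oX w t) * (cst (V w (Suc t)) (Q w (Suc t)) - bar cst (V w (Suc t))))"

lemma noise_measurable [measurable]: "noise m \<in> borel_measurable P"
  unfolding noise_def by measurable

lemma noise_increment: "\<bar>of_bool (oX w t) * (cst (V w s) (Q w s) - bar cst (V w s))\<bar> \<le> vbar"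
  using cst_VQ[of w s s] bar_cst_V[of w s] vbar_pos by (cases "oX w t") auto

lemma noise_abs: "\<bar>noise m w\<bar> \<le> real m * vbar"
proof -
  have "\<bar>noise m w\<bar> \<le> (\<Sum>t<m. \<bar>of_bool (oX w t) * (cst (V w (Suc t)) (Q w (Suc t)) - bar cst (V w (Suc t)))\<bar>)"
    unfolding noise_def by (rule sum_abs)
  also have "\<dots> \<le> (\<Sum>t<m. vbar)" by (intro sum_mono noise_increment)
  finally show ?thesis by simp
qed

lemma noise_update: "m < t \<Longrightarrow> noise m (w(t := y)) = noise m w"
  unfolding noise_def by (intro sum.cong refl) (simp add: update_X V_update Q_update)

text \<open>Increments are orthogonal: \<open>noise m\<close> times the decision of round
  \<open>Suc m\<close> does not depend on the bid of that round, so the cross term has mean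
  0.\<close>

lemma expect_noise_sq: "(\<integral>w. (noise m w)\<^sup>2 \<partial>P) \<le> real m * vbar\<^sup>2"
proof (induction m)
  case 0
  show ?case by (simp add: noise_def)
next
  case (Suc m)
  define D where "D w = of_bool (oX w m) * (cst (V w (Suc m)) (Q w (Suc m)) - bar cst (V w (Suc m)))" for w
  have noise_Suc: "noise (Suc m) w = noise m w + D w" for w by (simp add: noise_def D_def)
  have [measurable]: "D \<in> borel_measurable P" unfolding D_def by measurable
  have D: "\<bar>D w\<bar> \<le> vbar" for w unfolding D_def by (rule noise_increment)
  have sq: "\<bar>(noise m w)\<^sup>2\<bar> \<le> (real m * vbar)\<^sup>2" "\<bar>(D w)\<^sup>2\<bar> \<le> vbar\<^sup>2" for w
    using power_mono[OF noise_abs[of m w], of 2] power_mono[OF D[of w], of 2] by auto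
  have i1: "integrable P (\<lambda>w. (noise m w)\<^sup>2)" by (rule integrable_P[OF _ sq(1)]) measurable
  have i2: "integrable P (\<lambda>w. (D w)\<^sup>2)" by (rule integrable_P[OF _ sq(2)]) measurable
  define H where "H w = noise m w * of_bool (oX w m)" for w
  have [measurable]: "H \<in> borel_measurable P" unfolding H_def by measurable
  have H: "\<bar>H w\<bar> \<le> real m * vbar" for w
    using noise_abs[of m w] vbar_pos by (cases "oX w m") (auto simp: H_def)
  have b: "\<bar>H w * cst (V w (Suc m)) (Q w (Suc m))\<bar> \<le> real m * vbar * vbar"
    "\<bar>H w * bar cst (V w (Suc m))\<bar> \<le> real m * vbar * vbar" for w
    unfolding abs_mult using H[of w] cst_VQ[of w "Suc m" "Suc m"] bar_cst_V[of w "Suc m"]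
    by (intro mult_mono; auto)+
  have ib: "integrable P (\<lambda>w. H w * cst (V w (Suc m)) (Q w (Suc m)))"
    by (rule integrable_P[OF _ b(1)]) measurable
  have ic: "integrable P (\<lambda>w. H w * bar cst (V w (Suc m)))"
    by (rule integrable_P[OF _ b(2)]) measurable
  have ND: "noise m w * D w = H w * cst (V w (Suc m)) (Q w (Suc m)) - H w * bar cst (V w (Suc m))" for w
    by (simp add: H_def D_def algebra_simps)
  have "(\<integral>w. H w * cst (V w (Suc m)) (Q w (Suc m)) \<partial>P) = (\<integral>w. H w * bar cst (V w (Suc m)) \<partial>P)"
  proof (rule expect_bid[OF _ cst_pair_measurable H cst_abs])
    show "H (w(Suc m := (v, p, g))) = H (w(Suc m := (v, p', g')))" for w v p p' g g'
      unfolding H_def using update_bid_X[of w m v p g p' g'] by (simp add: noise_update)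
  qed measurable
  then have ND0: "(\<integral>w. noise m w * D w \<partial>P) = 0"
    unfolding ND using ib ic by (simp add: Bochner_Integration.integral_diff)
  have iND: "integrable P (\<lambda>w. noise m w * D w)" unfolding ND using ib ic by simp
  have "(\<integral>w. (noise (Suc m) w)\<^sup>2 \<partial>P) = (\<integral>w. (noise m w)\<^sup>2 + 2 * (noise m w * D w) + (D w)\<^sup>2 \<partial>P)"
    by (intro Bochner_Integration.integral_cong refl)
       (simp add: noise_Suc power2_eq_square algebra_simps)
  also have "\<dots> = (\<integral>w. (noise m w)\<^sup>2 \<partial>P) + 2 * (\<integral>w. noise m w * D w \<partial>P) + (\<integral>w. (D w)\<^sup>2 \<partial>P)"
    using i1 i2 iND by simp
  also have "(\<integral>w. (D w)\<^sup>2 \<partial>P) \<le> (\<integral>w. vbar\<^sup>2 \<partial>P)"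
    using i2 sq(2) by (intro integral_mono) auto
  finally show ?case using Suc ND0 by (simp add: P.prob_space[simplified] algebra_simps)
qed

text \<open>AM-GM with \<open>K = vbar * sqrt T\<close>, the bound on the root mean square, takes
  the place of the Cauchy-Schwarz inequality.\<close>

lemma expect_noise: "(\<integral>w. \<bar>noise T w\<bar> \<partial>P) \<le> vbar * sqrt (real T)"
proof -
  define K where "K = vbar * sqrt (real T)"
  have K: "0 < K" using vbar_pos T_ge by (simp add: K_def)
  have sq: "\<bar>(noise T w)\<^sup>2\<bar> \<le> (real T * vbar)\<^sup>2" for w
    using power_mono[OF noise_abs[of T w], of 2] by auto
  have i1: "integrable P (\<lambda>w. (noise T w)\<^sup>2)" by (rule integrable_P[OF _ sq]) measurable
  have i2: "integrable P (\<lambda>w. \<bar>noise T w\<bar>)" by (rule integrable_P[where K = "real T * vbar"]) (auto simp: noise_abs)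
  have amgm: "\<bar>x\<bar> \<le> x\<^sup>2 / (2 * K) + K / 2" for x :: real
  proof -
    have "0 \<le> (\<bar>x\<bar> - K)\<^sup>2" by simp
    then show ?thesis using K by (simp add: field_simps power2_eq_square)
  qed
  have "(\<integral>w. \<bar>noise T w\<bar> \<partial>P) \<le> (\<integral>w. (noise T w)\<^sup>2 / (2 * K) + K / 2 \<partial>P)"
    using i1 i2 by (intro integral_mono amgm) auto
  also have "\<dots> = (\<integral>w. (noise T w)\<^sup>2 \<partial>P) / (2 * K) + K / 2"
    using i1 by (simp add: P.prob_space[simplified])
  also have "\<dots> \<le> (real T * vbar\<^sup>2) / (2 * K) + K / 2"
    using expect_noise_sq[of T] K by (intro add_mono divide_right_mono) auto
  also have "real T * vbar\<^sup>2 = K * K" by (simp add: K_def power2_eq_square)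
  finally show ?thesis using K by (simp add: K_def[symmetric])
qed

text \<open>Since a decision does not depend on the bid of its round, the reward may be replaced by
  \<open>bar rwd\<close>. The gap to \<open>T * Rew\<close> is then the expected sum of
  \<open>bar rwd\<close> over the skipped rounds, which \<open>total_loss_le\<close>
  controls.\<close>

lemma expect_ogd_clipped:
  assumes Cost: "Cost \<le> rho"
  shows "real T * Rew - (\<integral>w. ogd_rev full vbar rho (V w) (Q w) T \<partial>P) \<le>
    slack + ((1 + Lam) * vbar + vbar / rho * vbar) * 2 + vbar / rho * (vbar * sqrt (real T))"
proof -
  define L where "L w = (\<Sum>t<T. of_bool (\<not> oX w t) * bar rwd (V w (Suc t)))" for w
  define D where "D w = (\<Sum>t<T. of_bool (oact w t) * olam w t * (bar cst (V w (Suc t)) - rho))" for w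
  define Bd where "Bd w = (\<Sum>t<T. of_bool (bad (bar rwd) (bar cst) (V w) (Q w) t) :: real)" for w
  let ?c = "(1 + Lam) * vbar + vbar / rho * vbar"
  have iX: "integrable P (\<lambda>w. of_bool (oX w t) * rwd (V w s) (Q w s))"
    "integrable P (\<lambda>w. of_bool (oX w t) * bar rwd (V w s))"
    "integrable P (\<lambda>w. bar rwd (V w s))"
    "integrable P (\<lambda>w. of_bool (\<not> oX w t) * bar rwd (V w s))" for t s
    using rwd_VQ bar_rwd_V vbar_pos by (auto intro!: integrable_P[where K = vbar])
  have "(\<integral>w. ogd_rev full vbar rho (V w) (Q w) T \<partial>P)
      = (\<Sum>t<T. \<integral>w. of_bool (oX w t) * rwd (V w (Suc t)) (Q w (Suc t)) \<partial>P)"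
    unfolding rev_eq by (intro Bochner_Integration.integral_sum iX)
  also have "\<dots> = (\<Sum>t<T. \<integral>w. of_bool (oX w t) * bar rwd (V w (Suc t)) \<partial>P)"
  proof (rule sum.cong[OF refl])
    fix t
    show "(\<integral>w. of_bool (oX w t) * rwd (V w (Suc t)) (Q w (Suc t)) \<partial>P)
        = (\<integral>w. of_bool (oX w t) * bar rwd (V w (Suc t)) \<partial>P)"
    proof (rule expect_bid[OF _ rwd_pair_measurable _ rwd_abs, where KH = 1])
      show "of_bool (oX (w(Suc t := (v, p, g))) t) = (of_bool (oX (w(Suc t := (v, p', g'))) t) :: real)" for w v p p' g g'
        using update_bid_X[of w t v p g p' g'] by simp
    qed auto
  qed
  also have "\<dots> = (\<Sum>t<T. Rew - (\<integral>w. of_bool (\<not> oX w t) * bar rwd (V w (Suc t)) \<partial>P))"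
  proof (rule sum.cong[OF refl])
    fix t
    have "(\<integral>w. of_bool (oX w t) * bar rwd (V w (Suc t)) \<partial>P)
        = (\<integral>w. bar rwd (V w (Suc t)) - of_bool (\<not> oX w t) * bar rwd (V w (Suc t)) \<partial>P)"
      by (intro Bochner_Integration.integral_cong refl) auto
    then show "(\<integral>w. of_bool (oX w t) * bar rwd (V w (Suc t)) \<partial>P)
        = Rew - (\<integral>w. of_bool (\<not> oX w t) * bar rwd (V w (Suc t)) \<partial>P)"
      using iX by (simp only: Bochner_Integration.integral_diff expect_bar_rwd)
  qed
  also have "\<dots> = real T * Rew - (\<integral>w. L w \<partial>P)"
    unfolding L_def Bochner_Integration.integral_sum[OF iX(4)] by (simp add: sum_subtractf)
  finally have LHS: "real T * Rew - (\<integral>w. ogd_rev full vbar rho (V w) (Q w) T \<partial>P) = (\<integral>w. L w \<partial>P)" by simp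
  have H: "\<bar>of_bool (oact w t) * olam w t\<bar> \<le> Lam" "0 \<le> of_bool (oact w t) * olam w t" for w t
    using lam_bounds[of "V w" "Q w" t] V_bounds Q_bounds Lam_pos by auto
  have iD: "integrable P (\<lambda>w. of_bool (oact w t) * olam w t * (bar cst (V w s) - rho))" for t s
  proof (rule integrable_P[where K = "Lam * vbar"])
    show "\<bar>of_bool (oact w t) * olam w t * (bar cst (V w s) - rho)\<bar> \<le> Lam * vbar" for w
      unfolding abs_mult[of "_ * _"] using H[of w t] bar_cst_V[of w s] rho0 rho_le Lam_pos
      by (intro mult_mono) auto
  qed measurable
  have D: "(\<integral>w. D w \<partial>P) \<le> 0"
  proof -
    have "(\<integral>w. D w \<partial>P) = (\<Sum>t<T. \<integral>w. of_bool (oact w t) * olam w t * (bar cst (V w (Suc t)) - rho) \<partial>P)"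
      unfolding D_def by (intro Bochner_Integration.integral_sum iD)
    also have "\<dots> \<le> (\<Sum>t<T. 0)"
      by (intro sum_mono expect_multiplier[OF _ H _ Cost]) (auto simp: update_state)
    finally show ?thesis by simp
  qed
  have iL: "integrable P L" unfolding L_def using iX by (intro Bochner_Integration.integrable_sum)
  have iD': "integrable P D" unfolding D_def using iD by (intro Bochner_Integration.integrable_sum)
  have iB: "integrable P Bd" "(\<integral>w. Bd w \<partial>P) \<le> 2" unfolding Bd_def by (rule expect_bad)+
  have iN: "integrable P (\<lambda>w. \<bar>noise T w\<bar>)" by (rule integrable_P[where K = "real T * vbar"]) (auto simp: noise_abs)
  have "(\<integral>w. L w \<partial>P) \<le> (\<integral>w. D w + slack + ?c * Bd w + vbar / rho * \<bar>noise T w\<bar> \<partial>P)"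
  proof (rule integral_mono[OF iL])
    show "integrable P (\<lambda>w. D w + slack + ?c * Bd w + vbar / rho * \<bar>noise T w\<bar>)"
      using iD' iB iN by simp
    show "L w \<le> D w + slack + ?c * Bd w + vbar / rho * \<bar>noise T w\<bar>" for w
      unfolding L_def D_def Bd_def noise_def
      using V_bounds Q_bounds bar_rwd_bounds bar_cst_bounds by (intro total_loss_le) auto
  qed
  also have "\<dots> = (\<integral>w. D w \<partial>P) + slack + ?c * (\<integral>w. Bd w \<partial>P) + vbar / rho * (\<integral>w. \<bar>noise T w\<bar> \<partial>P)"
    using iD' iB iN by (simp add: P.prob_space[simplified])
  also have "\<dots> \<le> 0 + slack + ?c * 2 + vbar / rho * (vbar * sqrt (real T))"
    using D iB(2) expect_noise vbar_pos rho0 Lam_pos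
    by (intro add_mono mult_left_mono order_refl) auto
  finally show ?thesis using LHS by simp
qed

end

subsection \<open>Adaptive pacing\<close>

lemma sum_of_bool_remaining_less:
  assumes "0 \<le> (x::real)"
  shows "(\<Sum>t<T. of_bool (real (T - t) < x)) \<le> x"
proof (induction T)
  case (Suc T)
  show ?case
  proof (cases "real (Suc T) < x")
    case True
    have "(\<Sum>t<Suc T. of_bool (real (Suc T - t) < x)) \<le> (\<Sum>t<Suc T. 1::real)" by (intro sum_mono) auto
    then show ?thesis using True by simp
  next
    case False
    then show ?thesis using Suc unfolding sum.lessThan_Suc_shift by simp
  qed
qed (use assms in simp)

locale pacing =
  fixes vbar rho mubar mu1 e :: real and T :: nat
  assumes vbar0: "0 < vbar" and rho0: "0 < rho" and rho_le: "rho \<le> vbar"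
    and mubar: "vbar / rho \<le> mubar" and mu1: "0 \<le> mu1" "mu1 \<le> mubar"
    and e0: "0 < e" and e_le: "e * vbar \<le> 1"
begin

definition mu :: "(nat \<Rightarrow> real) \<Rightarrow> (nat \<Rightarrow> real) \<Rightarrow> nat \<Rightarrow> real" where
  "mu v p t = fst (pac_state e mubar mu1 (rho * real T) rho v p t)"

definition bt :: "(nat \<Rightarrow> real) \<Rightarrow> (nat \<Rightarrow> real) \<Rightarrow> nat \<Rightarrow> real" where
  "bt v p t = snd (pac_state e mubar mu1 (rho * real T) rho v p t)"

definition bid :: "(nat \<Rightarrow> real) \<Rightarrow> (nat \<Rightarrow> real) \<Rightarrow> nat \<Rightarrow> real" where
  "bid v p t = min (v (Suc t) / (1 + mu v p t)) (bt v p t)"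

definition z :: "(nat \<Rightarrow> real) \<Rightarrow> (nat \<Rightarrow> real) \<Rightarrow> nat \<Rightarrow> real" where
  "z v p t = (if p (Suc t) \<le> bid v p t then p (Suc t) else 0)"

definition gain :: "(nat \<Rightarrow> real) \<Rightarrow> (nat \<Rightarrow> real) \<Rightarrow> nat \<Rightarrow> real" where
  "gain v p t = (if p (Suc t) \<le> bid v p t then v (Suc t) - p (Suc t) else 0)"

lemma pac_init: "mu v p 0 = mu1" "bt v p 0 = rho * real T"
  by (simp_all add: mu_def bt_def)

lemma pac_state_step: "pac_state e mubar mu1 (rho * real T) rho v p (Suc t) =
  (max 0 (min mubar (mu v p t - e * (rho - z v p t))), bt v p t - z v p t)"
  unfolding pac_state.simps Let_def z_def bid_def mu_def bt_def ..

lemma mu_step: "mu v p (Suc t) = max 0 (min mubar (mu v p t - e * (rho - z v p t)))"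
  unfolding mu_def[of v p "Suc t"] pac_state_step by simp

lemma bt_step: "bt v p (Suc t) = bt v p t - z v p t"
  unfolding bt_def[of v p "Suc t"] pac_state_step by simp

lemma pac_rev_eq: "pac_rev e mubar mu1 (rho * real T) rho v p T = (\<Sum>t<T. gain v p t)"
  unfolding pac_rev_def pac_bid_def Let_def gain_def bid_def mu_def bt_def
  by (rule sum.reindex_bij_witness[where i = Suc and j = "\<lambda>t. t - 1"]) auto

lemma mubar_pos: "0 < mubar"
  using mubar vbar0 rho0 by (meson divide_pos_pos less_le_trans)

lemma mu_bounds: "0 \<le> mu v p t \<and> mu v p t \<le> mubar"
  using mu1 mubar_pos by (cases t) (auto simp: pac_init mu_step)

lemma pac_state_cong:
  assumes "\<And>s. s \<in> {1..t} \<Longrightarrow> v s = v' s \<and> p s = p' s"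
  shows "pac_state e mubar mu1 (rho * real T) rho v p t = pac_state e mubar mu1 (rho * real T) rho v' p' t"
  using assms
proof (induction t)
  case (Suc t)
  then have "pac_state e mubar mu1 (rho * real T) rho v p t = pac_state e mubar mu1 (rho * real T) rho v' p' t" by simp
  moreover have "v (Suc t) = v' (Suc t)" "p (Suc t) = p' (Suc t)" using Suc.prems[of "Suc t"] by auto
  ultimately show ?case unfolding pac_state.simps by (simp only:)
qed simp

lemma mu_cong: "(\<And>s. s \<in> {1..t} \<Longrightarrow> v s = v' s \<and> p s = p' s) \<Longrightarrow> mu v p t = mu v' p' t"
  unfolding mu_def by (subst pac_state_cong) auto

context
  fixes M :: "'a measure" and v p :: "'a \<Rightarrow> nat \<Rightarrow> real"
  assumes v_measurable [measurable]: "\<And>t. (\<lambda>w. v w t) \<in> borel_measurable M"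
    and p_measurable [measurable]: "\<And>t. (\<lambda>w. p w t) \<in> borel_measurable M"
begin

lemma pac_state_measurable:
  "(\<lambda>w. mu (v w) (p w) t) \<in> borel_measurable M \<and> (\<lambda>w. bt (v w) (p w) t) \<in> borel_measurable M"
proof (induction t)
  case (Suc t)
  then have [measurable]: "(\<lambda>w. mu (v w) (p w) t) \<in> borel_measurable M" "(\<lambda>w. bt (v w) (p w) t) \<in> borel_measurable M"
    by auto
  show ?case unfolding mu_step bt_step z_def bid_def by (intro conjI) measurable
qed (simp add: pac_init)

lemma mu_measurable: "(\<lambda>w. mu (v w) (p w) t) \<in> borel_measurable M"
  using pac_state_measurable by blast

lemma gain_measurable: "(\<lambda>w. gain (v w) (p w) t) \<in> borel_measurable M"
proof -
  have [measurable]: "(\<lambda>w. mu (v w) (p w) t) \<in> borel_measurable M" "(\<lambda>w. bt (v w) (p w) t) \<in> borel_measurable M"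
    using pac_state_measurable by auto
  show ?thesis unfolding gain_def bid_def by measurable
qed

end

context
  fixes v p :: "nat \<Rightarrow> real"
  assumes v: "\<And>t. 0 \<le> v t \<and> v t \<le> vbar" and p: "\<And>t. 0 \<le> p t \<and> p t \<le> vbar"
begin

lemma shaded_le: "v (Suc t) / (1 + mu v p t) \<le> v (Suc t)"
  using v[of "Suc t"] mu_bounds[of v p t] by (simp add: divide_le_eq algebra_simps)

lemma bid_le: "bid v p t \<le> v (Suc t)"
  using shaded_le[of t] by (simp add: bid_def)

lemma z_bounds: "0 \<le> z v p t" "z v p t \<le> vbar"
  using p[of "Suc t"] vbar0 by (auto simp: z_def)

text \<open>The cap \<open>mubar\<close> never cuts off an increase: a payment above
  \<open>rho\<close> requires \<open>rho * (1 + mu) < v\<close>, so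
  \<open>mu \<le> vbar / rho - 1 \<le> mubar - 1\<close>, and a step adds at most
  \<open>e * vbar \<le> 1\<close>. Hence the multiplier records all overspending.\<close>

lemma mu_increase: "mu v p t + e * (z v p t - rho) \<le> mu v p (Suc t)"
proof -
  have "mu v p t - e * (rho - z v p t) \<le> mubar"
  proof (cases "z v p t \<le> rho")
    case True
    then have "0 \<le> e * (rho - z v p t)" using e0 by simp
    then show ?thesis using mu_bounds[of v p t] by linarith
  next
    case False
    then have "rho < v (Suc t) / (1 + mu v p t)" using rho0 by (auto simp: z_def bid_def split: if_splits)
    then have "rho * (1 + mu v p t) < v (Suc t)" using mu_bounds[of v p t] by (simp add: less_divide_eq)
    then have "1 + mu v p t \<le> vbar / rho" using rho0 v[of "Suc t"] by (simp add: le_divide_eq mult.commute)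
    moreover have "e * (z v p t - rho) \<le> e * vbar" using z_bounds(2)[of t] rho0 e0 by (intro mult_left_mono) auto
    ultimately show ?thesis using mubar e_le by (simp add: algebra_simps)
  qed
  then show ?thesis unfolding mu_step by (simp add: algebra_simps)
qed

lemma spent_le: "(\<Sum>s<t. z v p s) \<le> rho * real t + mubar / e"
proof -
  have "e * (\<Sum>s<t. z v p s - rho) \<le> mu v p t - mu1"
  proof (induction t)
    case (Suc t)
    then show ?case using mu_increase[of t] by (simp add: algebra_simps)
  qed (simp add: pac_init)
  also have "\<dots> \<le> mubar" using mu_bounds[of v p t] mu1 by linarith
  finally have "(\<Sum>s<t. z v p s - rho) \<le> mubar / e" using e0 by (simp add: le_divide_eq mult.commute)
  then show ?thesis by (simp add: sum_subtractf mult.commute)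
qed

lemma bt_eq: "bt v p t = rho * real T - (\<Sum>s<t. z v p s)"
  by (induction t) (auto simp: pac_init bt_step)

lemma bid_unconstrained:
  assumes "t < T" "vbar + mubar / e \<le> rho * real (T - t)"
  shows "bid v p t = v (Suc t) / (1 + mu v p t)"
proof -
  have "rho * real (T - t) = rho * real T - rho * real t" using assms(1) by (simp add: of_nat_diff algebra_simps)
  then have "vbar \<le> bt v p t" using spent_le[of t] assms(2) unfolding bt_eq by linarith
  then show ?thesis using shaded_le[of t] v[of "Suc t"] unfolding bid_def by linarith
qed

lemma gain_bounds: "0 \<le> gain v p t" "gain v p t \<le> rwd (v (Suc t)) (p (Suc t))"
  using bid_le[of t] by (auto simp: gain_def rwd_def)

text \<open>A round with \<open>p \<le> v\<close> that is lost at a bid not limited by the budget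
  satisfies \<open>v < p * (1 + mu)\<close>, that is \<open>v - p < mu * p\<close>, and there
  \<open>cst - z\<close> equals \<open>p\<close>. In the final rounds, where the budget may bind,
  the loss is at most \<open>vbar\<close>.\<close>

lemma pac_loss_le:
  assumes "t < T"
  shows "rwd (v (Suc t)) (p (Suc t)) - gain v p t \<le> mu v p t * (cst (v (Suc t)) (p (Suc t)) - z v p t)
    + vbar * of_bool (real (T - t) < (vbar + mubar / e) / rho)"
proof (cases "p (Suc t) \<le> bid v p t \<or> v (Suc t) < p (Suc t)")
  case True
  then show ?thesis using bid_le[of t] vbar0 by (auto simp: gain_def z_def rwd_def cst_def)
next
  case False
  then have lhs: "rwd (v (Suc t)) (p (Suc t)) - gain v p t = v (Suc t) - p (Suc t)"
    and rhs: "cst (v (Suc t)) (p (Suc t)) - z v p t = p (Suc t)"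
    by (auto simp: gain_def z_def rwd_def cst_def)
  have nn: "0 \<le> mu v p t * p (Suc t)" using mu_bounds p[of "Suc t"] by simp
  show ?thesis
  proof (cases "real (T - t) < (vbar + mubar / e) / rho")
    case True
    then show ?thesis using nn v[of "Suc t"] p[of "Suc t"] unfolding lhs rhs by simp
  next
    case unconstrained: False
    then have "vbar + mubar / e \<le> rho * real (T - t)" using rho0 by (simp add: not_less divide_le_eq mult.commute)
    then have "v (Suc t) / (1 + mu v p t) < p (Suc t)" using False bid_unconstrained[OF assms] by simp
    then have "v (Suc t) < p (Suc t) * (1 + mu v p t)" using mu_bounds[of v p t] by (simp add: divide_less_eq)
    then show ?thesis using unconstrained unfolding lhs rhs by (simp add: algebra_simps)
  qed
qed

text \<open>Gradient descent with constant step against the comparator 0; projecting onto an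
  interval that contains 0 does not increase the square.\<close>

lemma pac_regret: "(\<Sum>t<m. mu v p t * (rho - z v p t)) \<le> mu1\<^sup>2 / (2 * e) + real m * (e * vbar\<^sup>2 / 2) - (mu v p m)\<^sup>2 / (2 * e)"
proof (induction m)
  case (Suc m)
  define x where "x = mu v p m - e * (rho - z v p m)"
  have "(mu v p (Suc m))\<^sup>2 \<le> x\<^sup>2"
    unfolding mu_step x_def[symmetric] abs_le_square_iff[symmetric] using mubar_pos by auto
  also have "x\<^sup>2 = (mu v p m)\<^sup>2 - 2 * e * (mu v p m * (rho - z v p m)) + e\<^sup>2 * (rho - z v p m)\<^sup>2"
    by (simp add: x_def power2_eq_square algebra_simps)
  also have "e\<^sup>2 * (rho - z v p m)\<^sup>2 \<le> e\<^sup>2 * vbar\<^sup>2"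
    using z_bounds[of m] rho0 rho_le by (intro mult_left_mono) (auto simp flip: abs_le_square_iff)
  finally have "2 * e * (mu v p m * (rho - z v p m)) \<le> (mu v p m)\<^sup>2 - (mu v p (Suc m))\<^sup>2 + e\<^sup>2 * vbar\<^sup>2"
    by linarith
  then have "mu v p m * (rho - z v p m) \<le> ((mu v p m)\<^sup>2 - (mu v p (Suc m))\<^sup>2 + e\<^sup>2 * vbar\<^sup>2) / (2 * e)"
    using e0 by (simp add: le_divide_eq mult_ac)
  also have "\<dots> = (mu v p m)\<^sup>2 / (2 * e) - (mu v p (Suc m))\<^sup>2 / (2 * e) + e * vbar\<^sup>2 / 2"
    using e0 by (simp add: add_divide_distrib diff_divide_distrib power2_eq_square)
  finally have "mu v p m * (rho - z v p m) \<le> (mu v p m)\<^sup>2 / (2 * e) - (mu v p (Suc m))\<^sup>2 / (2 * e) + e * vbar\<^sup>2 / 2" .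
  moreover have "real (Suc m) * (e * vbar\<^sup>2 / 2) = real m * (e * vbar\<^sup>2 / 2) + e * vbar\<^sup>2 / 2"
    by (simp add: algebra_simps)
  ultimately show ?case using Suc unfolding sum.lessThan_Suc by linarith
qed (simp add: pac_init)

lemma pac_total_loss:
  "(\<Sum>t<T. rwd (v (Suc t)) (p (Suc t))) - (\<Sum>t<T. gain v p t) \<le>
    (\<Sum>t<T. mu v p t * (cst (v (Suc t)) (p (Suc t)) - rho))
    + (mubar\<^sup>2 / (2 * e) + real T * (e * vbar\<^sup>2 / 2) + vbar * ((vbar + mubar / e) / rho))"
proof -
  have "(\<Sum>t<T. rwd (v (Suc t)) (p (Suc t))) - (\<Sum>t<T. gain v p t)
      \<le> (\<Sum>t<T. mu v p t * (cst (v (Suc t)) (p (Suc t)) - z v p t)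
          + vbar * of_bool (real (T - t) < (vbar + mubar / e) / rho))"
    unfolding sum_subtractf[symmetric] by (intro sum_mono pac_loss_le) auto
  \<comment> \<open>Splitting \<open>cst - z\<close> at \<open>rho\<close>: the first part has
    nonpositive mean, the second is the dual regret.\<close>
  also have "\<dots> = (\<Sum>t<T. mu v p t * (cst (v (Suc t)) (p (Suc t)) - rho)) + (\<Sum>t<T. mu v p t * (rho - z v p t))
      + vbar * (\<Sum>t<T. of_bool (real (T - t) < (vbar + mubar / e) / rho))"
    unfolding sum_distrib_left sum.distrib[symmetric] by (intro sum.cong refl) (simp add: algebra_simps)
  also have "vbar * (\<Sum>t<T. of_bool (real (T - t) < (vbar + mubar / e) / rho)) \<le> vbar * ((vbar + mubar / e) / rho)"
    using vbar0 rho0 e0 mubar_pos by (intro mult_left_mono sum_of_bool_remaining_less divide_nonneg_nonneg add_nonneg_nonneg) auto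
  finally have "(\<Sum>t<T. rwd (v (Suc t)) (p (Suc t))) - (\<Sum>t<T. gain v p t) \<le>
    (\<Sum>t<T. mu v p t * (cst (v (Suc t)) (p (Suc t)) - rho)) + (\<Sum>t<T. mu v p t * (rho - z v p t))
      + vbar * ((vbar + mubar / e) / rho)" by simp
  moreover have "mu1\<^sup>2 / (2 * e) \<le> mubar\<^sup>2 / (2 * e)"
    using mu1 e0 by (intro divide_right_mono power_mono) auto
  moreover have "0 \<le> (mu v p T)\<^sup>2 / (2 * e)" using e0 by simp
  ultimately show ?thesis using pac_regret[of T] by linarith
qed

end

end

section \<open>Expected loss of adaptive pacing\<close>

locale auction_pacing = auction vbar F G + pacing vbar rho mubar mu1 e T
  for vbar F G rho mubar mu1 e T
begin

lemmas pac_clipped_measurable [measurable] =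
  mu_measurable[where v = V and p = Q, OF V_measurable Q_measurable] gain_measurable[where v = V and p = Q, OF V_measurable Q_measurable]

lemma expect_pac_clipped:
  assumes Cost: "Cost \<le> rho"
  shows "real T * Rew - (\<integral>w. (\<Sum>t<T. gain (V w) (Q w) t) \<partial>P) \<le>
    mubar\<^sup>2 / (2 * e) + real T * (e * vbar\<^sup>2 / 2) + vbar * ((vbar + mubar / e) / rho)" (is "_ \<le> ?s")
    and "(\<integral>w. (\<Sum>t<T. gain (V w) (Q w) t) \<partial>P) \<le> real T * Rew"
proof -
  define mw where "mw t w = mu (V w) (Q w) t" for t w
  have [measurable]: "mw t \<in> borel_measurable P" for t unfolding mw_def by measurable
  have mb: "\<bar>mw t w\<bar> \<le> mubar" "0 \<le> mw t w" for t w using mu_bounds[of "V w" "Q w" t] by (auto simp: mw_def)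
  have upd: "mw t (w(Suc t := y)) = mw t w" for t w y
    unfolding mw_def by (intro mu_cong) (simp add: V_update Q_update)
  have gb: "0 \<le> gain (V w) (Q w) t" "gain (V w) (Q w) t \<le> rwd (V w (Suc t)) (Q w (Suc t))" for w t
    using gain_bounds[of "V w" "Q w" t] V_bounds Q_bounds by auto
  have ig: "integrable P (\<lambda>w. gain (V w) (Q w) t)" for t
  proof (rule integrable_P[where K = vbar])
    show "\<bar>gain (V w) (Q w) t\<bar> \<le> vbar" for w
      using gb[of w t] rwd_VQ[of w "Suc t" "Suc t"] by linarith
  qed measurable
  have ir: "integrable P (\<lambda>w. rwd (V w (Suc t)) (Q w (Suc t)))" for t
    using rwd_VQ by (intro integrable_P[where K = vbar]) auto
  have bc: "\<bar>mw t w * cst (V w (Suc t)) (Q w (Suc t))\<bar> \<le> mubar * vbar"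
    "\<bar>mw t w * bar cst (V w (Suc t))\<bar> \<le> mubar * vbar" for t w
    unfolding abs_mult using mb[of t w] cst_VQ[of w "Suc t" "Suc t"] bar_cst_V[of w "Suc t"]
    by (intro mult_mono; auto)+
  have ic: "integrable P (\<lambda>w. mw t w * cst (V w (Suc t)) (Q w (Suc t)))"
    "integrable P (\<lambda>w. mw t w * bar cst (V w (Suc t)))" for t
    by (rule integrable_P[OF _ bc(1)], measurable) (rule integrable_P[OF _ bc(2)], measurable)
  have im: "integrable P (\<lambda>w. mw t w * rho)" for t
    by (intro integrable_mult_left integrable_P[OF _ mb(1)]) measurable
  have each: "(\<integral>w. mw t w * (cst (V w (Suc t)) (Q w (Suc t)) - rho) \<partial>P) \<le> 0" for t
  proof -
    have "(\<integral>w. mw t w * cst (V w (Suc t)) (Q w (Suc t)) \<partial>P) = (\<integral>w. mw t w * bar cst (V w (Suc t)) \<partial>P)"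
      by (rule expect_bid[OF _ cst_pair_measurable mb(1) cst_abs]) (auto simp: upd)
    then have "(\<integral>w. mw t w * (cst (V w (Suc t)) (Q w (Suc t)) - rho) \<partial>P)
        = (\<integral>w. mw t w * (bar cst (V w (Suc t)) - rho) \<partial>P)"
      using ic im by (simp add: right_diff_distrib)
    also have "\<dots> \<le> 0"
      by (rule expect_multiplier[OF _ mb _ Cost]) (auto simp: upd)
    finally show ?thesis .
  qed
  have id: "integrable P (\<lambda>w. mw t w * (cst (V w (Suc t)) (Q w (Suc t)) - rho))" for t
    unfolding right_diff_distrib using ic im by simp
  have sr: "(\<integral>w. (\<Sum>t<T. rwd (V w (Suc t)) (Q w (Suc t))) \<partial>P) = real T * Rew"
    using ir by (simp add: Bochner_Integration.integral_sum expect_rwd)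
  have "(\<integral>w. (\<Sum>t<T. gain (V w) (Q w) t) \<partial>P) \<le> (\<integral>w. (\<Sum>t<T. rwd (V w (Suc t)) (Q w (Suc t))) \<partial>P)"
    using ig ir by (intro integral_mono Bochner_Integration.integrable_sum sum_mono gb)
  then show "(\<integral>w. (\<Sum>t<T. gain (V w) (Q w) t) \<partial>P) \<le> real T * Rew" by (simp only: sr)
  have "real T * Rew - (\<integral>w. (\<Sum>t<T. gain (V w) (Q w) t) \<partial>P)
      = (\<integral>w. (\<Sum>t<T. rwd (V w (Suc t)) (Q w (Suc t))) - (\<Sum>t<T. gain (V w) (Q w) t) \<partial>P)"
    unfolding sr[symmetric] using ig ir
    by (intro Bochner_Integration.integral_diff[symmetric] Bochner_Integration.integrable_sum)
  also have "\<dots> \<le> (\<integral>w. (\<Sum>t<T. mw t w * (cst (V w (Suc t)) (Q w (Suc t)) - rho)) + ?s \<partial>P)"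
    using ig ir id V_bounds Q_bounds unfolding mw_def
    by (intro integral_mono Bochner_Integration.integrable_sum Bochner_Integration.integrable_diff
        Bochner_Integration.integrable_add pac_total_loss) auto
  also have "\<dots> = (\<integral>w. (\<Sum>t<T. mw t w * (cst (V w (Suc t)) (Q w (Suc t)) - rho)) \<partial>P) + ?s"
    using id by (subst Bochner_Integration.integral_add) (auto simp: P.prob_space[simplified])
  also have "(\<integral>w. (\<Sum>t<T. mw t w * (cst (V w (Suc t)) (Q w (Suc t)) - rho)) \<partial>P)
      = (\<Sum>t<T. \<integral>w. mw t w * (cst (V w (Suc t)) (Q w (Suc t)) - rho) \<partial>P)"
    by (intro Bochner_Integration.integral_sum id)
  also have "\<dots> \<le> (\<Sum>t<T. 0)" by (intro sum_mono each)
  finally show "real T * Rew - (\<integral>w. (\<Sum>t<T. gain (V w) (Q w) t) \<partial>P) \<le> ?s" by simp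
qed

lemma exp_pac_bounds:
  assumes Cost: "Cost \<le> rho" and e: "eps T = e"
  shows "real T * Rew - (mubar\<^sup>2 / (2 * e) + real T * (e * vbar\<^sup>2 / 2) + vbar * ((vbar + mubar / e) / rho))
      \<le> exp_pac F G eps mubar mu1 rho T"
    and "exp_pac F G eps mubar mu1 rho T \<le> real T * Rew"
proof -
  have "exp_pac F G eps mubar mu1 rho T = (\<integral>w. (\<Sum>t<T. gain (vv w) (pp w) t) \<partial>P)"
    unfolding exp_pac_def P_def e pac_rev_eq ..
  also have "\<dots> = (\<integral>w. (\<Sum>t<T. gain (V w) (Q w) t) \<partial>P)"
  proof (rule integral_cong_AE)
    show "AE w in P. (\<Sum>t<T. gain (vv w) (pp w) t) = (\<Sum>t<T. gain (V w) (Q w) t)"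
      using AE_clip by eventually_elim simp
  qed (use gain_measurable[where v = vv and p = pp, OF vv_measurable pp_measurable] in measurable)
  finally show "real T * Rew - (mubar\<^sup>2 / (2 * e) + real T * (e * vbar\<^sup>2 / 2) + vbar * ((vbar + mubar / e) / rho))
      \<le> exp_pac F G eps mubar mu1 rho T" "exp_pac F G eps mubar mu1 rho T \<le> real T * Rew"
    using expect_pac_clipped[OF Cost] by auto
qed

end

context ogd
begin

subsection \<open>OGD-CB as a throttling strategy\<close>

text \<open>The state only ever depends on observed bids, so the junk value of \<open>the None\<close> for an unobserved bid is harmless.\<close>

definition ogd_strategy :: thr_strategy where
  "ogd_strategy h x g = fst (ogd_dec vbar rho T (Suc (length h)) x
     (ogd_state full vbar rho T (\<lambda>t. fst (h ! (t - 1))) (\<lambda>t. the (snd (snd (h ! (t - 1))))) (length h)))"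

text \<open>An unobserved bid belongs to a skipped round, so it enters neither the list of bids nor
  the payment.\<close>

lemma st_cong_observed:
  assumes "\<And>s. s < t \<Longrightarrow> v (Suc s) = v' (Suc s)"
    and "\<And>s. s < t \<Longrightarrow> full \<or> X v p s \<Longrightarrow> p (Suc s) = p' (Suc s)"
  shows "st v p t = st v' p' t"
  using assms
proof (induction t)
  case 0
  show ?case by (simp add: st_def)
next
  case (Suc t)
  then have IH: "st v p t = st v' p' t" and vt: "v (Suc t) = v' (Suc t)" by simp_all
  have x: "X v p t = X v' p' t" unfolding X_eq_dec IH vt ..
  have a: "act v p t = act v' p' t" and b: "bids v p t = bids v' p' t" and c: "bud v p t = bud v' p' t"
    using IH by (simp_all add: act_def bids_def bud_def)
  show ?case
  proof (cases "act v p t")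
    case False
    then show ?thesis using IH a by (simp add: st_Suc_inactive)
  next
    case True
    have p1: "(if full \<or> X v' p' t then bids v' p' t @ [p (Suc t)] else bids v' p' t)
        = (if full \<or> X v' p' t then bids v' p' t @ [p' (Suc t)] else bids v' p' t)"
      using Suc.prems(2)[of t] x by (intro if_cong refl) simp
    have p2: "of_bool (X v' p' t) * cst (v' (Suc t)) (p (Suc t)) = of_bool (X v' p' t) * cst (v' (Suc t)) (p' (Suc t))"
      using Suc.prems(2)[of t] x by (cases "X v' p' t") simp_all
    show ?thesis
      unfolding st_Suc_active[OF True] st_Suc_active[OF True[unfolded a]] IH x b c vt p1 p2 ..
  qed
qed

lemma ogd_strategy_map:
  assumes "h = map (\<lambda>s. (v (Suc s), X v p s, obs full (X v p s) (p (Suc s)))) [0..<t]"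
  shows "ogd_strategy h (v (Suc t)) x = X v p t"
proof -
  have len: "length h = t" using assms by simp
  have "st v p t = st (\<lambda>t. fst (h ! (t - 1))) (\<lambda>t. the (snd (snd (h ! (t - 1))))) t"
    by (rule st_cong_observed) (auto simp: assms obs_def)
  then show ?thesis unfolding ogd_strategy_def X_eq_dec len by (simp add: st_def)
qed

lemma thr_hist_ogd_strategy:
  "thr_hist ogd_strategy full v p g t = map (\<lambda>s. (v (Suc s), X v p s, obs full (X v p s) (p (Suc s)))) [0..<t]"
proof (induction t)
  case (Suc t)
  show ?case unfolding thr_hist.simps Let_def Suc ogd_strategy_map[OF refl] by simp
qed simp

lemma thr_dec_ogd_strategy: "1 \<le> t \<Longrightarrow> thr_dec ogd_strategy full v p g t = X v p (t - 1)"
  using ogd_strategy_map[OF thr_hist_ogd_strategy[of v p g "t - 1"]] by (simp add: thr_dec_def)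

lemma thr_rev_ogd_strategy: "thr_rev ogd_strategy full v p g T = ogd_rev full vbar rho v p T"
  unfolding thr_rev_def rev_eq
  by (rule sum.reindex_bij_witness[where i = Suc and j = "\<lambda>t. t - 1"])
     (auto simp: thr_dec_ogd_strategy)

lemma thr_pay_ogd_strategy:
  "thr_pay ogd_strategy full v p g T = (\<Sum>t<T. of_bool (X v p t) * cst (v (Suc t)) (p (Suc t)))"
  unfolding thr_pay_def
  by (rule sum.reindex_bij_witness[where i = Suc and j = "\<lambda>t. t - 1"])
     (auto simp: thr_dec_ogd_strategy)

text \<open>An active round starts with at least \<open>vbar\<close> of budget, enough for any
  payment; for round 1 this is the assumption \<open>B\<close>.\<close>

lemma bud_nonneg:
  assumes v: "\<And>t. 0 \<le> v t \<and> v t \<le> vbar" and p: "\<And>t. 0 \<le> p t \<and> p t \<le> vbar"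
    and B: "vbar \<le> rho * real T"
  shows "0 \<le> bud v p t"
proof (induction t)
  case 0
  show ?case using B vbar0 by (simp add: init)
next
  case (Suc t)
  show ?case
  proof (cases "act v p t")
    case True
    then have "vbar \<le> bud v p t" using B by (cases t) (auto simp: init act_step)
    moreover have "cst (v (Suc t)) (p (Suc t)) \<le> vbar"
      using cst_bounds(2)[of "v (Suc t)" "p (Suc t)"] v[of "Suc t"] p[of "Suc t"] by linarith
    ultimately show ?thesis using Suc unfolding bud_step by (cases "X v p t") auto
  next
    case False
    then show ?thesis using Suc step_inactive by simp
  qed
qed

lemma ogd_strategy_admissible:
  assumes "vbar \<le> rho * real T"
  shows "thr_admissible ogd_strategy full vbar (rho * real T) T"
  unfolding thr_admissible_def thr_pay_ogd_strategy
proof (intro allI impI)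
  fix v p g :: "nat \<Rightarrow> real"
  assume "\<forall>t. 0 \<le> v t \<and> v t \<le> vbar \<and> 0 \<le> p t \<and> p t \<le> vbar \<and> 0 \<le> g t \<and> g t \<le> 1"
  then have v: "0 \<le> v t \<and> v t \<le> vbar" and p: "0 \<le> p t \<and> p t \<le> vbar" for t by auto
  show "(\<Sum>t<T. of_bool (X v p t) * cst (v (Suc t)) (p (Suc t))) \<le> rho * real T"
    using bud_nonneg[of v p, OF v p assms, of T] bud_eq[of v p, OF v p, of T] by simp
qed

end

section \<open>Bounds on the throttling optimum\<close>

context auction
begin

lemma expect_sum_rwd:
  "(\<integral>w. (\<Sum>t=1..T. rwd (V w t) (Q w t)) \<partial>P) = real T * Rew"
  "integrable P (\<lambda>w. \<Sum>t=1..T. rwd (V w t) (Q w t))"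
proof -
  have i: "integrable P (\<lambda>w. rwd (V w t) (Q w t))" for t
    using rwd_VQ by (intro integrable_P[where K = vbar]) auto
  show "integrable P (\<lambda>w. \<Sum>t=1..T. rwd (V w t) (Q w t))" using i by simp
  show "(\<integral>w. (\<Sum>t=1..T. rwd (V w t) (Q w t)) \<partial>P) = real T * Rew"
    using i by (simp add: Bochner_Integration.integral_sum expect_rwd)
qed

lemma Rew_nonneg: "0 \<le> Rew"
proof -
  have "0 \<le> (\<integral>w. rwd (V w 0) (Q w 0) \<partial>P)" using rwd_VQ by simp
  then show ?thesis by (simp only: expect_rwd)
qed

text \<open>Strategies need not be measurable; the integral of a non-integrable revenue is 0 by convention.\<close>

lemma expect_thr_rev_le:
  "(\<integral>w. thr_rev \<beta> full (vv w) (pp w) (gg w) T \<partial>P) \<le> real T * Rew"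
proof (cases "integrable P (\<lambda>w. thr_rev \<beta> full (vv w) (pp w) (gg w) T)")
  case True
  have "(\<integral>w. thr_rev \<beta> full (vv w) (pp w) (gg w) T \<partial>P) \<le> (\<integral>w. (\<Sum>t=1..T. rwd (V w t) (Q w t)) \<partial>P)"
  proof (rule integral_mono_AE[OF True expect_sum_rwd(2)])
    have le: "thr_rev \<beta> full v p g T \<le> (\<Sum>t=1..T. rwd (v t) (p t))" for v p g
      unfolding thr_rev_def by (intro sum_mono) (simp add: rwd_def)
    show "AE w in P. thr_rev \<beta> full (vv w) (pp w) (gg w) T \<le> (\<Sum>t=1..T. rwd (V w t) (Q w t))"
      using AE_clip by eventually_elim (use le in force)
  qed
  then show ?thesis by (simp only: expect_sum_rwd)
next
  case False
  then show ?thesis using Rew_nonneg by (simp add: not_integrable_integral_eq)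
qed

lemma exp_thr_opt_le:
  assumes "0 \<le> rho"
  shows "exp_thr_opt F G full vbar rho T \<le> real T * Rew"
  unfolding exp_thr_opt_def P_def[symmetric]
proof (rule cSup_least)
  \<comment> \<open>Never participating is admissible, so the supremum ranges over a nonempty
    set.\<close>
  have "thr_admissible (\<lambda>_ _ _. False) full vbar (rho * real T) T"
    using assms by (simp add: thr_admissible_def thr_pay_def thr_dec_def)
  then show "(\<lambda>\<beta>. \<integral>w. thr_rev \<beta> full (vv w) (pp w) (gg w) T \<partial>P) ` {\<beta>. thr_admissible \<beta> full vbar (rho * real T) T} \<noteq> {}"
    by blast
qed (use expect_thr_rev_le in auto)

lemma exp_thr_opt_ge:
  assumes "thr_admissible \<beta> full vbar (rho * real T) T"
  shows "(\<integral>w. thr_rev \<beta> full (vv w) (pp w) (gg w) T \<partial>P) \<le> exp_thr_opt F G full vbar rho T"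
  unfolding exp_thr_opt_def P_def[symmetric]
  by (rule cSup_upper) (use assms expect_thr_rev_le in \<open>auto intro!: bdd_aboveI2\<close>)

lemma Cost_eq: "Cost = (\<integral>x. cst (fst x) (snd x) \<partial>(F \<Otimes>\<^sub>M G))"
proof -
  interpret FG: pair_prob_space F G ..
  have aeF: "AE x in F \<Otimes>\<^sub>M G. fst x \<in> {0..vbar}"
  proof (rule FG.AE_pair_measure)
    show "{x \<in> space (F \<Otimes>\<^sub>M G). fst x \<in> {0..vbar}} \<in> sets (F \<Otimes>\<^sub>M G)" by measurable
  qed (use AE_F in auto)
  have aeG: "AE x in F \<Otimes>\<^sub>M G. snd x \<in> {0..vbar}"
  proof (rule FG.AE_pair_measure)
    show "{x \<in> space (F \<Otimes>\<^sub>M G). snd x \<in> {0..vbar}} \<in> sets (F \<Otimes>\<^sub>M G)" by measurable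
  qed (use AE_G in auto)
  have b: "\<bar>cst (clip vbar u) (clip vbar q)\<bar> \<le> vbar" for u q
    using vbar_pos by (intro cst_abs) (auto simp: clip_bounds)
  have "(\<integral>x. cst (fst x) (snd x) \<partial>(F \<Otimes>\<^sub>M G)) = (\<integral>x. cst (clip vbar (fst x)) (clip vbar (snd x)) \<partial>(F \<Otimes>\<^sub>M G))"
  proof (rule integral_cong_AE)
    show "AE x in F \<Otimes>\<^sub>M G. cst (fst x) (snd x) = cst (clip vbar (fst x)) (clip vbar (snd x))"
      using aeF aeG by eventually_elim (simp add: clip_id)
  qed measurable
  also have "\<dots> = (\<integral>u. (\<integral>q. cst (clip vbar (fst (u, q))) (clip vbar (snd (u, q))) \<partial>G) \<partial>F)"
    by (rule FG.integral_fst'[symmetric], rule integrable_bounded[where K = vbar])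
       (use b in \<open>auto simp: FG.finite_measure_axioms\<close>)
  also have "\<dots> = Cost" by (simp add: Cost_def bar_def)
  finally show ?thesis ..
qed

end

context auction_ogd
begin

lemma exp_ogd_ge:
  assumes "Cost \<le> rho"
  shows "real T * Rew - (slack + ((1 + Lam) * vbar + vbar / rho * vbar) * 2 + vbar / rho * (vbar * sqrt (real T)))
    \<le> exp_ogd F G full vbar rho T"
proof -
  have "exp_ogd F G full vbar rho T = (\<integral>w. ogd_rev full vbar rho (V w) (Q w) T \<partial>P)"
    unfolding exp_ogd_def P_def[symmetric]
  proof (rule integral_cong_AE)
    show "AE w in P. ogd_rev full vbar rho (vv w) (pp w) T = ogd_rev full vbar rho (V w) (Q w) T"
      using AE_clip by eventually_elim simp
  qed (rule rev_measurable; measurable)+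
  then show ?thesis using expect_ogd_clipped[OF assms] by linarith
qed

lemma exp_ogd_le_exp_thr_opt:
  assumes "vbar \<le> rho * real T"
  shows "exp_ogd F G full vbar rho T \<le> exp_thr_opt F G full vbar rho T"
  using exp_thr_opt_ge[OF ogd_strategy_admissible[OF assms]]
  by (simp add: thr_rev_ogd_strategy exp_ogd_def P_def)

end

theorem theorem10:
  fixes vbar rho mubar mu1 :: real and F G :: "real measure"
    and eps :: "nat \<Rightarrow> real" and full :: bool
  assumes "0 < vbar" and "0 < rho" and "rho \<le> vbar"
    and "prob_space F" and "sets F = sets borel" and "measure F {0..vbar} = 1"
    and "prob_space G" and "sets G = sets borel" and "measure G {0..vbar} = 1"
    and "vbar / rho \<le> mubar" and "0 \<le> mu1" and "mu1 \<le> mubar"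
    and "\<forall>T. 0 < eps T" and "eps \<in> \<Theta>(\<lambda>T. 1 / sqrt (real T))"
    and "(\<integral>x. cst (fst x) (snd x) \<partial>(F \<Otimes>\<^sub>M G)) \<le> rho"
  shows "(\<lambda>T. \<bar>exp_thr_opt F G full vbar rho T - exp_pac F G eps mubar mu1 rho T\<bar>)
           \<in> O(\<lambda>T. sqrt (real T * ln (real T))) \<and>
         (\<lambda>T. \<bar>exp_ogd F G full vbar rho T - exp_pac F G eps mubar mu1 rho T\<bar>)
           \<in> O(\<lambda>T. sqrt (real T * ln (real T)))"
proof -
  interpret auction vbar F G by (rule auction.intro; fact)
  have Cost: "Cost \<le> rho" using assms(15) by (simp only: Cost_eq)
  let ?g = "\<lambda>T. sqrt (real T * ln (real T))"
  \<comment> \<open>\<open>Lm\<close> and \<open>eo\<close> restate the OGD-CB bound with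
    \<open>T\<close> as a variable, since \<open>Lam\<close>, \<open>A\<close> and
    \<open>slack\<close> belong to a locale in which \<open>T\<close> is fixed. \<open>ep\<close>
    groups the pacing bound by \<open>1 / eps T\<close> and \<open>T * eps T\<close>, both of order
    \<open>sqrt T\<close>.\<close>
  define Lm where "Lm = 3 * vbar / (2 * rho) + 1"
  define eo where "eo T = (vbar / 2 * Lm\<^sup>2 * sqrt (real T) + 2 * vbar * sqrt (real T) + 4 * vbar * (ln 2 + 2 * ln (real T)) * ln (real T)
    + vbar / rho * (2 * vbar + Lm * vbar * sqrt (real T) + 9 * vbar * sqrt ((ln 2 + 2 * ln (real T)) / 2) * sqrt (real T)))
    + ((1 + Lm) * vbar + vbar / rho * vbar) * 2 + vbar / rho * (vbar * sqrt (real T))" for T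
  define ep where "ep T = mubar\<^sup>2 / 2 * (1 / eps T) + vbar\<^sup>2 / 2 * (real T * eps T) + (vbar\<^sup>2 / rho + vbar * mubar / rho * (1 / eps T))" for T
  have eo: "eo \<in> O(?g)" unfolding eo_def by real_asymp
  have eps_O: "eps \<in> O(\<lambda>T. 1 / sqrt (real T))" and eps_Om: "(\<lambda>T. 1 / sqrt (real T)) \<in> O(eps)"
    using assms(14) by (auto simp: bigtheta_def bigomega_iff_bigo)
  have "(\<lambda>T. inverse (eps T)) \<in> O(\<lambda>T. inverse (1 / sqrt (real T)))"
  proof (rule landau_o.big.inverse[OF _ _ eps_Om])
    show "\<forall>\<^sub>F T in sequentially. 1 / sqrt (real T) \<noteq> 0"
      using eventually_gt_at_top[of 0] by eventually_elim simp
    show "\<forall>\<^sub>F T in sequentially. eps T \<noteq> 0" using assms(13) by (intro always_eventually allI) (simp add: less_imp_neq[symmetric])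
  qed
  also have "(\<lambda>T. inverse (1 / sqrt (real T))) \<in> O(?g)" by real_asymp
  finally have inv: "(\<lambda>T. 1 / eps T) \<in> O(?g)" by (simp add: inverse_eq_divide)
  have "(\<lambda>T. real T * eps T) \<in> O(\<lambda>T. real T * (1 / sqrt (real T)))"
    using eps_O by (intro landau_o.big.mult) auto
  also have "(\<lambda>T. real T * (1 / sqrt (real T))) \<in> O(?g)" by real_asymp
  finally have Te: "(\<lambda>T. real T * eps T) \<in> O(?g)" .
  have const: "(\<lambda>T. c) \<in> O(?g)" for c :: real by real_asymp
  have cmult: "(\<lambda>T. c * f T) \<in> O(?g)" if "f \<in> O(?g)" for c :: real and f
  proof -
    have "(\<lambda>_. c) \<in> O(\<lambda>_::nat. 1 :: real)" by simp
    from landau_o.big.mult[OF this that] show ?thesis by simp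
  qed
  have ep: "ep \<in> O(?g)" unfolding ep_def
    by (intro sum_in_bigo const cmult inv Te)
  \<comment> \<open>Needed so that \<open>eps T * vbar \<le> 1\<close> holds eventually, as the
    locale \<open>pacing\<close> requires.\<close>
  have "eps \<longlonglongrightarrow> 0"
  proof -
    have "(\<lambda>T. 1 / sqrt (real T)) \<in> o(\<lambda>_. 1)" by real_asymp
    then have "eps \<in> o(\<lambda>_. 1)" using eps_O by (rule landau_o.big_small_trans[rotated])
    then show ?thesis using smalloD_tendsto[of eps _ "\<lambda>_. 1"] by simp
  qed
  then have ev1: "\<forall>\<^sub>F T in sequentially. eps T < 1 / vbar"
    using assms(1) by (intro order_tendstoD) auto
  \<comment> \<open>Eventually the initial budget covers one payment, which makes OGD-CB an
    admissible throttling strategy.\<close>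
  have ev2: "\<forall>\<^sub>F T in sequentially. vbar \<le> rho * real T" using assms(2) by real_asymp
  have main: "\<forall>\<^sub>F T in sequentially.
      \<bar>exp_thr_opt F G full vbar rho T - exp_pac F G eps mubar mu1 rho T\<bar> \<le> eo T + ep T \<and>
      \<bar>exp_ogd F G full vbar rho T - exp_pac F G eps mubar mu1 rho T\<bar> \<le> eo T + ep T"
    using ev1 ev2 eventually_ge_at_top[of 1]
  proof eventually_elim
    case (elim T)
    interpret O: auction_ogd vbar F G full rho T
      by (rule auction_ogd.intro[OF auction_axioms], rule ogd.intro) (use assms(1-3) elim in simp_all)
    interpret Pc: auction_pacing vbar F G rho mubar mu1 "eps T" T
      by (rule auction_pacing.intro[OF auction_axioms], rule pacing.intro)
        (use assms(1-3,10-13) elim in \<open>simp_all add: field_simps\<close>)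
    have "real T * Rew - eo T \<le> exp_ogd F G full vbar rho T"
      using O.exp_ogd_ge[OF Cost] unfolding eo_def O.slack_def O.Lam_def O.A_def Lm_def .
    moreover have "exp_ogd F G full vbar rho T \<le> exp_thr_opt F G full vbar rho T"
      using elim by (intro O.exp_ogd_le_exp_thr_opt)
    moreover have "exp_thr_opt F G full vbar rho T \<le> real T * Rew"
      using assms(2) by (intro exp_thr_opt_le) simp
    moreover have "real T * Rew - ep T \<le> exp_pac F G eps mubar mu1 rho T"
      using Pc.exp_pac_bounds(1)[OF Cost, where eps = eps, OF refl]
      by (simp add: ep_def power2_eq_square add_divide_distrib algebra_simps)
    moreover have "exp_pac F G eps mubar mu1 rho T \<le> real T * Rew"
      using Pc.exp_pac_bounds(2)[OF Cost, where eps = eps, OF refl] .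
    ultimately show ?case by linarith
  qed
  have sum: "(\<lambda>T. eo T + ep T) \<in> O(?g)" using eo ep by (rule sum_in_bigo)
  have 1: "(\<lambda>T. \<bar>exp_thr_opt F G full vbar rho T - exp_pac F G eps mubar mu1 rho T\<bar>) \<in> O(\<lambda>T. eo T + ep T)"
    by (rule landau_o.big_mono) (use main in \<open>auto elim!: eventually_mono\<close>)
  have 2: "(\<lambda>T. \<bar>exp_ogd F G full vbar rho T - exp_pac F G eps mubar mu1 rho T\<bar>) \<in> O(\<lambda>T. eo T + ep T)"
    by (rule landau_o.big_mono) (use main in \<open>auto elim!: eventually_mono\<close>)
  show ?thesis using landau_o.big_trans[OF 1 sum] landau_o.big_trans[OF 2 sum] by blast
qed

end
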